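(* There is no coarsely minimal infinite dimensional Banach space; that is, there is no infinite dimensional Banach space $X$ such that $X$ coarsely embeds into every infinite dimensional Banach space.
   Context: All Banach spaces are real. A Banach space is called coarsely minimal if it coarsely embeds into every infinite dimensional Banach space. For a map $f:(X,d_X)\to(Y,d_Y)$ between metric spaces put $\rho_f(t)=\inf\{d_Y(f(x),f(y)): d_X(x,y)\ge t\}$ and $\omega_f(t)=\sup\{d_Y(f(x),f(y)): d_X(x,y)\le t\}$, with $\inf\emptyset=+\infty$, $\sup\emptyset=0$. $f$ is a coarse embedding if $\lim_{t\to\infty}\rho_f(t)=\infty$ and $\omega_f(t)<\infty$ for all $t>0$. $X$ coarsely embeds into $Y$ if there is a coarse embedding $f:X\to Y$. *)

theory Defs
  imports "HOL-Analysis.Analysis" "HOL-Algebra.Module"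
begin

section \<open>Real Banach spaces on carrier sets\<close>

text \<open>Quantification over all Banach spaces inside a formula is not possible with the type class
  \<^class>\<open>banach\<close>, so Banach spaces are structures on carrier sets: a module over the field of
  real numbers together with a norm.\<close>

definition real_ring :: "real ring" where
  "real_ring = \<lparr>carrier = UNIV, mult = (*), one = 1, zero = 0, add = (+)\<rparr>"

text \<open>As usual for \<^type>\<open>module_scheme\<close>, the inherited fields \<^const>\<open>mult\<close> and \<^const>\<open>one\<close>
  of the structure itself carry no meaning.\<close>

record 'a normed_space = "(real, 'a) module" +
  nrm :: "'a \<Rightarrow> real"

text \<open>The type \<^type>\<open>metric\<close> requires the distance function to be symmetric and nonnegative even
  outside the carrier, hence the case distinction.\<close>

definition norm_dist :: "'a normed_space \<Rightarrow> 'a \<Rightarrow> 'a \<Rightarrow> real" where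
  "norm_dist X x y =
    (if x \<in> carrier X \<and> y \<in> carrier X then nrm X (x \<ominus>\<^bsub>X\<^esub> y) else 0)"

definition norm_metric :: "'a normed_space \<Rightarrow> 'a metric" where
  "norm_metric X = metric (carrier X, norm_dist X)"

definition real_normed_space :: "'a normed_space \<Rightarrow> bool" where
  "real_normed_space X \<longleftrightarrow>
    Module.module real_ring X \<and>
    (\<forall>x\<in>carrier X. 0 \<le> nrm X x \<and> (nrm X x = 0 \<longleftrightarrow> x = \<zero>\<^bsub>X\<^esub>)) \<and>
    (\<forall>c. \<forall>x\<in>carrier X. nrm X (c \<odot>\<^bsub>X\<^esub> x) = \<bar>c\<bar> * nrm X x) \<and>
    (\<forall>x\<in>carrier X. \<forall>y\<in>carrier X. nrm X (x \<oplus>\<^bsub>X\<^esub> y) \<le> nrm X x + nrm X y)"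

definition banach_space :: "'a normed_space \<Rightarrow> bool" where
  "banach_space X \<longleftrightarrow> real_normed_space X \<and> mcomplete_of (norm_metric X)"

definition finite_dimensional :: "'a normed_space \<Rightarrow> bool" where
  "finite_dimensional X \<longleftrightarrow>
    (\<exists>B. finite B \<and> B \<subseteq> carrier X \<and>
      (\<forall>x\<in>carrier X. \<exists>c::'a \<Rightarrow> real. x = (\<Oplus>\<^bsub>X\<^esub>b\<in>B. c b \<odot>\<^bsub>X\<^esub> b)))"

abbreviation infinite_dimensional :: "'a normed_space \<Rightarrow> bool" where
  "infinite_dimensional X \<equiv> \<not> finite_dimensional X"

text \<open>The case distinction in \<^const>\<open>norm_dist\<close> is harmless: \<^const>\<open>norm_metric\<close> is the metric
  space with underlying set the carrier and with distance the norm of the difference.\<close>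

lemma Metric_space_norm_dist:
  assumes "real_normed_space X"
  shows "Metric_space (carrier X) (norm_dist X)"
proof -
  interpret Module.module real_ring X
    using assms by (simp add: real_normed_space_def)
  have nonneg: "0 \<le> nrm X x" and zero: "nrm X x = 0 \<longleftrightarrow> x = \<zero>\<^bsub>X\<^esub>" if "x \<in> carrier X" for x
    using assms that by (auto simp: real_normed_space_def)
  have scale: "nrm X (c \<odot>\<^bsub>X\<^esub> x) = \<bar>c\<bar> * nrm X x" if "x \<in> carrier X" for c x
    using assms that by (auto simp: real_normed_space_def)
  have tri: "nrm X (x \<oplus>\<^bsub>X\<^esub> y) \<le> nrm X x + nrm X y" if "x \<in> carrier X" "y \<in> carrier X" for x y
    using assms that by (auto simp: real_normed_space_def)
  have carrier_R: "c \<in> carrier real_ring" for c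
    by (simp add: real_ring_def)
  have one_R: "\<one>\<^bsub>real_ring\<^esub> = 1"
    by (simp add: real_ring_def)
  have minus_one: "\<ominus>\<^bsub>real_ring\<^esub> \<one>\<^bsub>real_ring\<^esub> = -1"
    by (rule R.minus_equality) (simp_all add: real_ring_def)
  have neg: "nrm X (\<ominus>\<^bsub>X\<^esub> x) = nrm X x" if "x \<in> carrier X" for x
  proof -
    have "\<ominus>\<^bsub>X\<^esub> x = (-1) \<odot>\<^bsub>X\<^esub> x"
      using smult_l_minus[of "\<one>\<^bsub>real_ring\<^esub>" x] that minus_one by (simp add: carrier_R)
    then show ?thesis
      using scale[OF that, of "-1"] by simp
  qed
  show ?thesis
  proof
    fix x y
    show "0 \<le> norm_dist X x y"
      by (auto simp: norm_dist_def intro!: nonneg)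
    show "norm_dist X x y = norm_dist X y x"
    proof (cases "x \<in> carrier X \<and> y \<in> carrier X")
      case True
      then have "\<ominus>\<^bsub>X\<^esub> (x \<ominus>\<^bsub>X\<^esub> y) = y \<ominus>\<^bsub>X\<^esub> x"
        by (simp add: a_minus_def M.minus_add M.a_comm)
      then show ?thesis
        using True neg[of "x \<ominus>\<^bsub>X\<^esub> y"] by (simp add: norm_dist_def)
    qed (auto simp: norm_dist_def)
  next
    fix x y
    assume xy: "x \<in> carrier X" "y \<in> carrier X"
    then have "(x \<ominus>\<^bsub>X\<^esub> y) \<oplus>\<^bsub>X\<^esub> y = x"
      by (simp add: a_minus_def M.a_assoc M.l_neg)
    then have "x \<ominus>\<^bsub>X\<^esub> y = \<zero>\<^bsub>X\<^esub> \<longleftrightarrow> x = y"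
      using xy by (metis M.l_zero M.r_neg a_minus_def)
    then show "norm_dist X x y = 0 \<longleftrightarrow> x = y"
      using xy by (simp add: norm_dist_def zero)
  next
    fix x y z
    assume xyz: "x \<in> carrier X" "y \<in> carrier X" "z \<in> carrier X"
    then have "x \<ominus>\<^bsub>X\<^esub> z = (x \<ominus>\<^bsub>X\<^esub> y) \<oplus>\<^bsub>X\<^esub> (y \<ominus>\<^bsub>X\<^esub> z)"
      by (simp add: a_minus_def M.a_assoc M.r_neg1)
    then show "norm_dist X x z \<le> norm_dist X x y + norm_dist X y z"
      using xyz tri[of "x \<ominus>\<^bsub>X\<^esub> y" "y \<ominus>\<^bsub>X\<^esub> z"] by (simp add: norm_dist_def)
  qed
qed

lemma mspace_norm_metric [simp]:
  "real_normed_space X \<Longrightarrow> mspace (norm_metric X) = carrier X"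
  by (simp add: norm_metric_def Metric_space.mspace_metric Metric_space_norm_dist)

lemma mdist_norm_metric:
  "\<lbrakk>real_normed_space X; x \<in> carrier X; y \<in> carrier X\<rbrakk> \<Longrightarrow>
    mdist (norm_metric X) x y = nrm X (x \<ominus>\<^bsub>X\<^esub> y)"
  by (simp add: norm_metric_def Metric_space.mdist_metric Metric_space_norm_dist norm_dist_def)


section \<open>Coarse embeddings\<close>

text \<open>In \<^typ>\<open>ennreal\<close> the infimum of the empty set is \<open>\<infinity>\<close> and its supremum is \<open>0\<close>, which are
  exactly the conventions wanted for the two moduli.\<close>

definition compression_modulus ::
  "'a metric \<Rightarrow> 'b metric \<Rightarrow> ('a \<Rightarrow> 'b) \<Rightarrow> real \<Rightarrow> ennreal" where
  "compression_modulus m1 m2 f t =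
    Inf {ennreal (mdist m2 (f x) (f y)) | x y.
          x \<in> mspace m1 \<and> y \<in> mspace m1 \<and> mdist m1 x y \<ge> t}"

definition expansion_modulus ::
  "'a metric \<Rightarrow> 'b metric \<Rightarrow> ('a \<Rightarrow> 'b) \<Rightarrow> real \<Rightarrow> ennreal" where
  "expansion_modulus m1 m2 f t =
    Sup {ennreal (mdist m2 (f x) (f y)) | x y.
          x \<in> mspace m1 \<and> y \<in> mspace m1 \<and> mdist m1 x y \<le> t}"

definition coarse_embedding :: "'a metric \<Rightarrow> 'b metric \<Rightarrow> ('a \<Rightarrow> 'b) \<Rightarrow> bool" where
  "coarse_embedding m1 m2 f \<longleftrightarrow>
    f ` mspace m1 \<subseteq> mspace m2 \<and>
    (compression_modulus m1 m2 f \<longlongrightarrow> \<infinity>) at_top \<and>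
    (\<forall>t>0. expansion_modulus m1 m2 f t < \<infinity>)"

definition coarsely_embeds :: "'a metric \<Rightarrow> 'b metric \<Rightarrow> bool" where
  "coarsely_embeds m1 m2 \<longleftrightarrow> (\<exists>f. coarse_embedding m1 m2 f)"

text \<open>A type cannot be quantified inside a formula, so the target spaces range over the Banach
  spaces whose carrier is a subset of the same arbitrary type \<open>'a\<close> that hosts \<open>X\<close>.  This is implied
  by embeddability into all Banach spaces of whatever cardinality, so the nonexistence of coarsely
  minimal spaces in this sense is at least as strong as nonexistence in the unrestricted sense.
  It is no degenerate notion either: a type hosting one infinite dimensional Banach space has at
  least the cardinality of the continuum and hence hosts an isometric copy of every separable
  Banach space.\<close>

definition coarsely_minimal :: "'a normed_space \<Rightarrow> bool" where
  "coarsely_minimal X \<longleftrightarrow>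
    (\<forall>Y::'a normed_space. banach_space Y \<and> infinite_dimensional Y \<longrightarrow>
      coarsely_embeds (norm_metric X) (norm_metric Y))"

end

theory Submission
  imports Defs "HOL-Library.Function_Algebras" "HOL-Library.Poly_Mapping"
begin

text \<open>No infinite dimensional normed space \<open>X\<close> embeds coarsely both into Tsirelson's original space
\<open>T*\<close> and into Hilbert space \<open>\<ell>\<^sub>2\<close>; since both are infinite dimensional Banach spaces, the
theorem follows. An embedding into \<open>T*\<close> forces \<open>X\<close> to contain cubes as flat as those of
\<open>\<ell>\<^sub>\<infinity>\<close>, of every dimension, and such cubes do not embed into \<open>\<ell>\<^sub>2\<close>.

The flat cubes (\<open>flat_vectors\<close>). In \<open>T*\<close>, any \<open>k\<close> successive blocks of norm at most
\<open>L\<close> that are supported beyond \<open>k\<close> have a sum of norm at most \<open>3 L\<close> (\<open>dual_le_blocks\<close>), while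
on the other hand every vector of \<open>T*\<close> has tails of arbitrarily small norm (\<open>tail_small\<close>), and
bounded sets are relatively compact for coordinatewise convergence. Hence a map from \<open>k\<close>-tuples
of natural numbers into \<open>T*\<close> that moves by at most \<open>L\<close> when one entry changes is, up to a
constant and a small error, a sum of \<open>k\<close> such blocks on suitable cubes of tuples, and oscillates
on them by at most \<open>8 L\<close>, whatever \<open>k\<close> is (\<open>tree_approximation\<close>, \<open>concentration\<close>). The map of
interest sends a tuple \<open>m\<close> to the image of \<open>x(m\<^sub>1) + \<dots> + x(m\<^sub>k)\<close>, where \<open>x\<close> is a separated
sequence in the unit ball of \<open>X\<close>. Pulling the bound back to \<open>X\<close> gives a constant \<open>C\<close> and,
for every \<open>k\<close>, vectors \<open>y\<^sub>1, \<dots>, y\<^sub>k\<close> of norm at least \<open>1/2\<close> all of whose signed sums have norm at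
most \<open>C\<close>.

The obstruction in \<open>\<ell>\<^sub>2\<close> (\<open>cube_obstruction\<close>). Put the discrete torus of dimension
\<open>k = 2\<^sup>n\<close> into \<open>X\<close> by running along each \<open>y\<^sub>j\<close> with a triangle wave, and let \<open>N v\<close> be the sum
over the torus of the squared distances in \<open>\<ell>\<^sub>2\<close> between the images of \<open>z\<close> and \<open>z + v\<close>.
Squared Hilbert distances satisfy
\<open>E N(a - a') + E N(b - b') \<le> 2 E N(a - b)\<close> for independent random vectors, where
\<open>a, a'\<close> have one law and \<open>b, b'\<close> another. Iterating this \<open>n\<close> times trades dimension for length:
the mean of \<open>N\<close> over one random step in all \<open>2\<^sup>n\<close> coordinates simultaneously, which is bounded
because the cube is flat, dominates the average over the coordinates of the mean of \<open>N\<close> at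
\<open>2\<^sup>n\<close> random steps in that one coordinate (\<open>avg_walk_le_combine\<close>). Such a walk ends at distance
about \<open>2\<^sup>n\<^sup>/\<^sup>2\<close> with probability bounded below, so the compression modulus stays bounded.

The theorem concerns structures on subsets of an arbitrary type, so both targets are copied there:
a type that hosts a nonzero real vector space contains a line, hence the reals, hence a copy of the
set of all real sequences.\<close>

section \<open>Sequence spaces normed by test vectors\<close>

definition pairing :: "(nat \<Rightarrow> real) \<Rightarrow> (nat \<Rightarrow> real) \<Rightarrow> real" where
  "pairing y x = (\<Sum>n | x n \<noteq> 0. y n * x n)"

lemma pairing_eq_sum:
  assumes "finite S" "{n. x n \<noteq> 0} \<subseteq> S"
  shows "pairing y x = (\<Sum>n\<in>S. y n * x n)"
  unfolding pairing_def using assms by (intro sum.mono_neutral_left) auto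

lemma pairing_add: "pairing (y + z) x = pairing y x + pairing z x"
  and pairing_diff: "pairing (y - z) x = pairing y x - pairing z x"
  and pairing_scale: "pairing (\<lambda>n. c * y n) x = c * pairing y x"
  and pairing_uminus: "pairing y (- x) = - pairing y x"
  and pairing_zero: "pairing 0 x = 0"
  by (simp_all add: pairing_def sum.distrib sum_subtractf sum_distrib_left algebra_simps sum_negf)

text \<open>Bounds on the norm are used far more often than its value, and they are statements about one test
vector at a time. The predicate \<open>dual_le\<close> makes sense for sequences of infinite norm too, so limits
can be treated before membership in the space is known.\<close>

definition dual_le :: "(nat \<Rightarrow> real) set \<Rightarrow> (nat \<Rightarrow> real) \<Rightarrow> real \<Rightarrow> bool" where
  "dual_le B y c \<longleftrightarrow> (\<forall>x\<in>B. pairing y x \<le> c)"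

definition dual_carrier :: "(nat \<Rightarrow> real) set \<Rightarrow> (nat \<Rightarrow> real) set" where
  "dual_carrier B = {y. \<exists>c. dual_le B y c}"

definition dual_norm :: "(nat \<Rightarrow> real) set \<Rightarrow> (nat \<Rightarrow> real) \<Rightarrow> real" where
  "dual_norm B y = (SUP x\<in>B. pairing y x)"

definition unit_seq :: "nat \<Rightarrow> nat \<Rightarrow> real" where
  "unit_seq n m = (if m = n then 1 else 0)"

lemma pairing_unit_seq: "pairing y (unit_seq n) = y n"
  by (subst pairing_eq_sum[of "{n}"]) (auto simp: unit_seq_def)

text \<open>Both target spaces are duals: the norm of a sequence is its supremum against a symmetric set of
finitely supported test vectors. Coordinates are then bounded, and the unit ball is closed under
coordinatewise limits.\<close>

locale test_set =
  fixes B :: "(nat \<Rightarrow> real) set"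
  assumes finite_support: "x \<in> B \<Longrightarrow> finite {n. x n \<noteq> 0}"
    and uminus_mem: "x \<in> B \<Longrightarrow> - x \<in> B"
    and unit_seq_mem: "unit_seq n \<in> B"
begin

lemma dual_le_coord: "dual_le B y c \<Longrightarrow> \<bar>y n\<bar> \<le> c"
  using unit_seq_mem[of n] uminus_mem[OF unit_seq_mem[of n]] unfolding dual_le_def
  by (metis abs_le_iff pairing_uminus pairing_unit_seq)

lemma dual_le_nonneg: "dual_le B y c \<Longrightarrow> 0 \<le> c"
  using dual_le_coord[of y c 0] by linarith

lemma dual_le_abs: "dual_le B y c \<Longrightarrow> x \<in> B \<Longrightarrow> \<bar>pairing y x\<bar> \<le> c"
  using uminus_mem[of x] unfolding dual_le_def by (metis abs_le_iff pairing_uminus)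

lemma dual_le_add: "dual_le B y c \<Longrightarrow> dual_le B z d \<Longrightarrow> dual_le B (y + z) (c + d)"
  by (force simp: dual_le_def pairing_add intro: add_mono)

lemma dual_le_scale: "dual_le B y c \<Longrightarrow> dual_le B (\<lambda>n. a * y n) (\<bar>a\<bar> * c)"
  unfolding dual_le_def[of _ _ "\<bar>a\<bar> * c"]
proof
  fix x assume "dual_le B y c" "x \<in> B"
  then have "\<bar>a\<bar> * \<bar>pairing y x\<bar> \<le> \<bar>a\<bar> * c"
    by (intro mult_left_mono dual_le_abs) auto
  then show "pairing (\<lambda>n. a * y n) x \<le> \<bar>a\<bar> * c"
    by (simp add: pairing_scale flip: abs_mult)
qed

lemma unit_seq_dual_carrier:
  assumes "\<And>x. x \<in> B \<Longrightarrow> x n \<le> 1"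
  shows "unit_seq n \<in> dual_carrier B"
proof -
  have "pairing (unit_seq n) x = x n" if "x \<in> B" for x
  proof -
    have "pairing (unit_seq n) x = (\<Sum>k\<in>{k. x k \<noteq> 0}. if k = n then x n else 0)"
      unfolding pairing_def by (intro sum.cong) (auto simp: unit_seq_def)
    also have "\<dots> = x n" using finite_support[OF that] by (simp add: sum.delta)
    finally show ?thesis .
  qed
  then show ?thesis using assms by (auto simp: dual_carrier_def dual_le_def)
qed

lemma dual_le_minus: "dual_le B y c \<Longrightarrow> dual_le B (- y) c"
  using dual_le_scale[of y c "-1"] by (simp add: fun_Compl_def)

lemma dual_le_diff: "dual_le B y c \<Longrightarrow> dual_le B z d \<Longrightarrow> dual_le B (y - z) (c + d)"
  using dual_le_add[OF _ dual_le_minus, of y c z d] by simp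

lemma dual_le_mono: "dual_le B y c \<Longrightarrow> c \<le> d \<Longrightarrow> dual_le B y d"
  by (force simp: dual_le_def)

lemma dual_le_lim:
  assumes lim: "\<And>n. (\<lambda>i. s i n) \<longlonglongrightarrow> y n" and le: "\<And>i. i \<ge> k \<Longrightarrow> dual_le B (s i) c"
  shows "dual_le B y c"
  unfolding dual_le_def
proof
  fix x assume x: "x \<in> B"
  have "(\<lambda>i. pairing (s i) x) \<longlonglongrightarrow> pairing y x"
    unfolding pairing_def by (intro tendsto_intros lim)
  moreover have "eventually (\<lambda>i. pairing (s i) x \<le> c) sequentially"
    using le x by (auto simp: eventually_sequentially dual_le_def intro!: exI[of _ k])
  ultimately show "pairing y x \<le> c"
    by (rule tendsto_upperbound) simp
qed

lemma dual_norm_le_iff: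
  assumes "y \<in> dual_carrier B"
  shows "dual_norm B y \<le> c \<longleftrightarrow> dual_le B y c"
proof -
  have "bdd_above (pairing y ` B)"
    using assms by (auto simp: dual_carrier_def dual_le_def bdd_above_def)
  then show ?thesis
    unfolding dual_norm_def dual_le_def using unit_seq_mem by (subst cSUP_le_iff) auto
qed

lemma dual_le_norm: "y \<in> dual_carrier B \<Longrightarrow> dual_le B y (dual_norm B y)"
  using dual_norm_le_iff by blast

lemma dual_norm_nonneg: "y \<in> dual_carrier B \<Longrightarrow> 0 \<le> dual_norm B y"
  using dual_le_norm dual_le_nonneg by blast

lemma dual_carrierI: "dual_le B y c \<Longrightarrow> y \<in> dual_carrier B"
  by (auto simp: dual_carrier_def)

lemma dual_carrier_zero: "0 \<in> dual_carrier B"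
  by (rule dual_carrierI[of _ 0]) (simp add: dual_le_def pairing_zero)

lemma dual_carrier_add: "y \<in> dual_carrier B \<Longrightarrow> z \<in> dual_carrier B \<Longrightarrow> y + z \<in> dual_carrier B"
  by (meson dual_le_norm dual_le_add dual_carrierI)

lemma dual_carrier_scale: "y \<in> dual_carrier B \<Longrightarrow> (\<lambda>n. a * y n) \<in> dual_carrier B"
  by (rule dual_carrierI[OF dual_le_scale[OF dual_le_norm]])

lemma dual_carrier_minus: "y \<in> dual_carrier B \<Longrightarrow> - y \<in> dual_carrier B"
  by (meson dual_le_norm dual_le_minus dual_carrierI)

lemma dual_carrier_diff: "y \<in> dual_carrier B \<Longrightarrow> z \<in> dual_carrier B \<Longrightarrow> y - z \<in> dual_carrier B"
  by (meson dual_le_norm dual_le_diff dual_carrierI)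

lemma dual_norm_triangle:
  "y \<in> dual_carrier B \<Longrightarrow> z \<in> dual_carrier B \<Longrightarrow> dual_norm B (y + z) \<le> dual_norm B y + dual_norm B z"
  by (simp add: dual_norm_le_iff dual_carrier_add dual_le_add dual_le_norm)

lemma dual_norm_scale_le:
  "y \<in> dual_carrier B \<Longrightarrow> dual_norm B (\<lambda>n. a * y n) \<le> \<bar>a\<bar> * dual_norm B y"
  by (simp add: dual_norm_le_iff dual_carrier_scale dual_le_scale dual_le_norm)

lemma dual_norm_eq_0_iff:
  assumes "y \<in> dual_carrier B"
  shows "dual_norm B y = 0 \<longleftrightarrow> y = 0"
proof
  assume "dual_norm B y = 0"
  then have "dual_le B y 0" using dual_le_norm[OF assms] by simp
  then show "y = 0" using dual_le_coord[of y 0] by (auto simp: fun_eq_iff)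
next
  assume "y = 0"
  moreover have "dual_le B 0 0" by (simp add: dual_le_def pairing_zero)
  ultimately show "dual_norm B y = 0"
    using dual_norm_le_iff[OF assms, of 0] dual_norm_nonneg[OF assms] by auto
qed

lemma dual_norm_scale:
  assumes "y \<in> dual_carrier B"
  shows "dual_norm B (\<lambda>n. a * y n) = \<bar>a\<bar> * dual_norm B y"
proof (cases "a = 0")
  case True
  then show ?thesis using dual_norm_eq_0_iff[OF dual_carrier_zero] by (simp add: zero_fun_def)
next
  case False
  then have "dual_norm B y \<le> \<bar>1 / a\<bar> * dual_norm B (\<lambda>n. a * y n)"
    using dual_norm_scale_le[OF dual_carrier_scale[OF assms, of a], of "1/a"] by simp
  then have "\<bar>a\<bar> * dual_norm B y \<le> dual_norm B (\<lambda>n. a * y n)"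
    using False by (simp add: field_simps)
  then show ?thesis using dual_norm_scale_le[OF assms, of a] by linarith
qed

text \<open>A Cauchy sequence converges in each coordinate, and the Cauchy estimates survive the coordinatewise
limit because each of them concerns finitely many coordinates of finitely supported test vectors.\<close>

lemma dual_norm_complete:
  fixes s :: "nat \<Rightarrow> nat \<Rightarrow> real"
  assumes mem: "\<And>i. s i \<in> dual_carrier B"
    and cauchy: "\<And>e. e > 0 \<Longrightarrow> \<exists>M. \<forall>i\<ge>M. \<forall>k\<ge>M. dual_norm B (s i - s k) < e"
  shows "\<exists>y\<in>dual_carrier B. \<forall>e>0. \<exists>M. \<forall>i\<ge>M. dual_norm B (s i - y) < e"
proof -
  have le: "dual_le B (s i - s k) e" if "dual_norm B (s i - s k) < e" for i k e
    using that dual_norm_le_iff[OF dual_carrier_diff[OF mem[of i] mem[of k]], of e] by simp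
  have "Cauchy (\<lambda>i. s i n)" for n
    unfolding Cauchy_def dist_real_def
  proof (intro allI impI)
    fix e :: real assume "e > 0"
    then obtain M where M: "\<forall>i\<ge>M. \<forall>k\<ge>M. dual_norm B (s i - s k) < e / 2"
      using cauchy[of "e / 2"] by auto
    have "\<bar>s i n - s k n\<bar> < e" if "i \<ge> M" "k \<ge> M" for i k
      using dual_le_coord[OF le, of i k "e/2" n] M that \<open>e > 0\<close> by force
    then show "\<exists>M. \<forall>m\<ge>M. \<forall>k\<ge>M. \<bar>s m n - s k n\<bar> < e" by blast
  qed
  then have "\<forall>n. \<exists>l. (\<lambda>i. s i n) \<longlonglongrightarrow> l"
    by (simp add: Cauchy_convergent_iff convergent_def)
  then obtain y where y: "\<And>n. (\<lambda>i. s i n) \<longlonglongrightarrow> y n" by metis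
  have close: "dual_le B (s i - y) e" if M: "\<forall>i\<ge>M. \<forall>k\<ge>M. dual_norm B (s i - s k) < e" "i \<ge> M" for M i e
  proof (rule dual_le_lim)
    show "(\<lambda>k. (s i - s k) n) \<longlonglongrightarrow> (s i - y) n" for n
      using y by (simp add: tendsto_diff)
    show "dual_le B (s i - s k) e" if "k \<ge> M" for k
      using le M that by blast
  qed
  have y_mem: "y \<in> dual_carrier B"
  proof -
    obtain M where "\<forall>i\<ge>M. \<forall>k\<ge>M. dual_norm B (s i - s k) < 1" using cauchy[of 1] by auto
    then have "s M - y \<in> dual_carrier B" using close[of M 1 M] dual_carrierI by blast
    then have "s M - (s M - y) \<in> dual_carrier B" using mem dual_carrier_diff by blast
    then show ?thesis by simp
  qed
  moreover have "\<exists>M. \<forall>i\<ge>M. dual_norm B (s i - y) < e" if "e > 0" for e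
  proof -
    obtain M where M: "\<forall>i\<ge>M. \<forall>k\<ge>M. dual_norm B (s i - s k) < e / 2"
      using cauchy[of "e / 2"] \<open>e > 0\<close> by auto
    have "dual_norm B (s i - y) < e" if "i \<ge> M" for i
    proof -
      have "dual_norm B (s i - y) \<le> e / 2"
        using close[OF M that] dual_norm_le_iff[OF dual_carrier_diff[OF mem y_mem]] by blast
      then show ?thesis using \<open>e > 0\<close> by linarith
    qed
    then show ?thesis by blast
  qed
  ultimately show ?thesis by blast
qed

end

abbreviation decode :: "('b \<Rightarrow> 'a) \<Rightarrow> 'a \<Rightarrow> 'b" where
  "decode j \<equiv> inv_into UNIV j"

text \<open>The injection \<open>j\<close> copies the sequence space onto a subset of an arbitrary type that is large
enough. The fields \<open>mult\<close> and \<open>one\<close> carry no meaning in a module.\<close>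

definition seq_space :: "((nat \<Rightarrow> real) \<Rightarrow> 'a) \<Rightarrow> (nat \<Rightarrow> real) set \<Rightarrow> 'a normed_space" where
  "seq_space j B = \<lparr>carrier = j ` dual_carrier B, mult = (\<lambda>x y. x), one = j 0, zero = j 0,
     add = (\<lambda>x y. j (decode j x + decode j y)), smult = (\<lambda>c x. j (\<lambda>n. c * decode j x n)),
     nrm = (\<lambda>x. dual_norm B (decode j x))\<rparr>"

lemma cring_real_ring: "cring real_ring"
proof (rule cringI)
  show "abelian_group real_ring"
    by (rule abelian_groupI) (auto simp: real_ring_def intro: exI[of _ "- _"] add.left_inverse)
  show "Group.comm_monoid real_ring"
    by (rule comm_monoidI) (auto simp: real_ring_def)
qed (auto simp: real_ring_def algebra_simps)

locale dual_space = test_set +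
  fixes j :: "(nat \<Rightarrow> real) \<Rightarrow> 'a"
  assumes inj: "inj j"
begin

abbreviation "Y \<equiv> seq_space j B"

lemma decode [simp]: "decode j (j y) = y"
  by (simp add: inj)

lemma seq_space_simps [simp]:
  "carrier Y = j ` dual_carrier B" "\<zero>\<^bsub>Y\<^esub> = j 0"
  "x \<oplus>\<^bsub>Y\<^esub> z = j (decode j x + decode j z)" "c \<odot>\<^bsub>Y\<^esub> x = j (\<lambda>n. c * decode j x n)"
  "nrm Y x = dual_norm B (decode j x)"
  by (simp_all add: seq_space_def)

lemma abelian_group_seq_space: "abelian_group Y"
proof (rule abelian_groupI)
  show "\<exists>z\<in>carrier Y. z \<oplus>\<^bsub>Y\<^esub> x = \<zero>\<^bsub>Y\<^esub>" if "x \<in> carrier Y" for x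
  proof -
    obtain y where "x = j y" "y \<in> dual_carrier B" using \<open>x \<in> carrier Y\<close> by auto
    then show ?thesis by (intro bexI[of _ "j (- y)"]) (auto simp: dual_carrier_minus)
  qed
qed (auto simp: dual_carrier_add dual_carrier_zero add_ac)

lemma module_seq_space: "Module.module real_ring Y"
proof (rule moduleI[OF cring_real_ring abelian_group_seq_space])
qed (auto simp: dual_carrier_scale real_ring_def fun_eq_iff algebra_simps inj_eq[OF inj])

lemma normed_seq_space: "real_normed_space Y"
  unfolding real_normed_space_def
  by (auto simp: module_seq_space dual_norm_nonneg dual_norm_eq_0_iff dual_norm_scale
      dual_norm_triangle inj_eq[OF inj])

lemma minus_seq_space:
  assumes "y \<in> dual_carrier B" "z \<in> dual_carrier B"
  shows "j y \<ominus>\<^bsub>Y\<^esub> j z = j (y - z)"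
proof -
  interpret abelian_group Y by (rule abelian_group_seq_space)
  have "\<ominus>\<^bsub>Y\<^esub> j z = j (- z)"
    by (rule minus_equality) (use assms dual_carrier_minus in auto)
  then show ?thesis by (simp add: a_minus_def)
qed

lemma mdist_seq_space:
  assumes "y \<in> dual_carrier B" "z \<in> dual_carrier B"
  shows "mdist (norm_metric Y) (j y) (j z) = dual_norm B (y - z)"
  using assms by (subst mdist_norm_metric[OF normed_seq_space]) (simp_all add: minus_seq_space)

lemma banach_seq_space: "banach_space Y"
proof -
  interpret M: Metric_space "carrier Y" "norm_dist Y"
    by (rule Metric_space_norm_dist[OF normed_seq_space])
  have "M.mcomplete"
    unfolding M.mcomplete_def
  proof (intro allI impI)
    fix \<sigma> assume C: "M.MCauchy \<sigma>"
    define s where "s i = decode j (\<sigma> i)" for i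
    have s: "\<sigma> i = j (s i)" "s i \<in> dual_carrier B" for i
    proof -
      have "\<sigma> i \<in> carrier Y" using C[unfolded M.MCauchy_def] by blast
      then show "\<sigma> i = j (s i)" "s i \<in> dual_carrier B" by (auto simp: s_def)
    qed
    have d: "norm_dist Y (j y) (j z) = dual_norm B (y - z)"
      if "y \<in> dual_carrier B" "z \<in> dual_carrier B" for y z
      using that by (simp add: norm_dist_def minus_seq_space)
    have "\<exists>y\<in>dual_carrier B. \<forall>e>0. \<exists>M. \<forall>i\<ge>M. dual_norm B (s i - y) < e"
    proof (rule dual_norm_complete)
      show "\<exists>M. \<forall>i\<ge>M. \<forall>k\<ge>M. dual_norm B (s i - s k) < e" if "e > 0" for e
        using C that unfolding M.MCauchy_def by (simp add: s d)
    qed (rule s)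
    then obtain y where "y \<in> dual_carrier B" "\<And>e. e>0 \<Longrightarrow> \<exists>M. \<forall>i\<ge>M. dual_norm B (s i - y) < e"
      by blast
    then have "limitin M.mtopology \<sigma> (j y) sequentially"
      unfolding M.limit_metric_sequentially by (auto simp: s d)
    then show "\<exists>x. limitin M.mtopology \<sigma> x sequentially" by blast
  qed
  then show ?thesis
    using normed_seq_space unfolding banach_space_def norm_metric_def M.mcomplete_of by blast
qed

end

interpretation seqvec: vector_space "\<lambda>(c::real) (y::nat \<Rightarrow> real) n. c * y n"
  by unfold_locales (auto simp: fun_eq_iff algebra_simps)

lemma independent_unit_seq: "seqvec.independent (range unit_seq)"
proof
  assume "seqvec.dependent (range unit_seq)"
  then obtain t u where t: "finite t" "t \<subseteq> range unit_seq" "(\<Sum>v\<in>t. (\<lambda>n. u v * v n)) = 0"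
    and v: "\<exists>v\<in>t. u v \<noteq> 0"
    unfolding seqvec.dependent_explicit by auto
  from v t obtain n where n: "unit_seq n \<in> t" "u (unit_seq n) \<noteq> 0" by auto
  have "u (unit_seq n) * unit_seq n n + (\<Sum>v\<in>t - {unit_seq n}. u v * v n) = (\<Sum>v\<in>t. u v * v n)"
    using n t by (simp add: sum.remove)
  also have "\<dots> = (\<Sum>v\<in>t. (\<lambda>n. u v * v n)) n"
    using \<open>finite t\<close> by (induction t rule: finite_induct) auto
  also have "\<dots> = 0" using t by simp
  finally have *: "u (unit_seq n) * unit_seq n n + (\<Sum>v\<in>t - {unit_seq n}. u v * v n) = 0" .
  have "(\<Sum>v\<in>t - {unit_seq n}. u v * v n) = 0"
  proof (rule sum.neutral, rule ballI)
    fix v assume v: "v \<in> t - {unit_seq n}"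
    then obtain m where "v = unit_seq m" using t(2) by auto
    with v have "m \<noteq> n" by auto
    with \<open>v = unit_seq m\<close> show "u v * v n = 0" by (simp add: unit_seq_def)
  qed
  with * n show False by (simp add: unit_seq_def)
qed

context dual_space
begin

lemma infinite_dimensional_seq_space:
  assumes unit: "\<And>n. unit_seq n \<in> dual_carrier B"
  shows "infinite_dimensional Y"
proof
  assume "finite_dimensional Y"
  then obtain S where S: "finite S" "S \<subseteq> carrier Y"
    and span: "\<And>x. x \<in> carrier Y \<Longrightarrow> \<exists>c::'a \<Rightarrow> real. x = (\<Oplus>\<^bsub>Y\<^esub>b\<in>S. c b \<odot>\<^bsub>Y\<^esub> b)"
    unfolding finite_dimensional_def by blast
  interpret abelian_group Y by (rule abelian_group_seq_space)
  have fs: "(\<Oplus>\<^bsub>Y\<^esub>b\<in>S. c b \<odot>\<^bsub>Y\<^esub> b) \<in> j ` seqvec.span (decode j ` S)" for c :: "'a \<Rightarrow> real"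
    using S
  proof (induction S rule: finite_induct)
    case empty
    then show ?case by (simp add: seqvec.span_zero flip: zero_fun_def)
  next
    case (insert b S)
    have cl: "(\<lambda>b. c b \<odot>\<^bsub>Y\<^esub> b) \<in> S \<rightarrow> carrier Y" "c b \<odot>\<^bsub>Y\<^esub> b \<in> carrier Y"
      using insert.prems by (auto simp: dual_carrier_scale)
    obtain z where z: "(\<Oplus>\<^bsub>Y\<^esub>b\<in>S. c b \<odot>\<^bsub>Y\<^esub> b) = j z" "z \<in> seqvec.span (decode j ` S)"
      using insert by auto
    have "(\<Oplus>\<^bsub>Y\<^esub>b\<in>insert b S. c b \<odot>\<^bsub>Y\<^esub> b) = c b \<odot>\<^bsub>Y\<^esub> b \<oplus>\<^bsub>Y\<^esub> (\<Oplus>\<^bsub>Y\<^esub>b\<in>S. c b \<odot>\<^bsub>Y\<^esub> b)"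
      using insert.hyps cl by (rule finsum_insert)
    also have "\<dots> = j ((\<lambda>n. c b * decode j b n) + z)" by (simp add: z(1)[unfolded seq_space_simps])
    finally have eq: "(\<Oplus>\<^bsub>Y\<^esub>b\<in>insert b S. c b \<odot>\<^bsub>Y\<^esub> b) = j ((\<lambda>n. c b * decode j b n) + z)" .
    have "z \<in> seqvec.span (decode j ` insert b S)"
      using z(2) seqvec.span_mono[of "decode j ` S" "decode j ` insert b S"] by auto
    moreover have "(\<lambda>n. c b * decode j b n) \<in> seqvec.span (decode j ` insert b S)"
      by (intro seqvec.span_scale[of "decode j b"] seqvec.span_base) auto
    ultimately show ?case
      unfolding eq by (intro imageI seqvec.span_add)
  qed
  have "range unit_seq \<subseteq> seqvec.span (decode j ` S)"
  proof
    fix y assume "y \<in> range unit_seq"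
    then have "j y \<in> carrier Y" using unit by auto
    then obtain c :: "'a \<Rightarrow> real" where "j y = (\<Oplus>\<^bsub>Y\<^esub>b\<in>S. c b \<odot>\<^bsub>Y\<^esub> b)" using span by blast
    then have "j y \<in> j ` seqvec.span (decode j ` S)" using fs[of c] by simp
    then show "y \<in> seqvec.span (decode j ` S)" by (simp add: inj inj_image_mem_iff)
  qed
  then have "finite (range unit_seq)"
    using seqvec.independent_span_bound[OF _ independent_unit_seq] S(1) by blast
  moreover have "inj unit_seq"
    by (rule injI) (metis unit_seq_def zero_neq_one)
  ultimately show False using finite_imageD infinite_UNIV_nat by blast
qed

end

text \<open>A sequence of reals is coded by the set of pairs \<open>(n, k)\<close> such that \<open>k\<close> belongs to the set of
natural numbers that codes the \<open>n\<close>-th entry.\<close>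

lemma sequences_lepoll_reals: "(UNIV :: (nat \<Rightarrow> real) set) \<lesssim> (UNIV :: real set)"
proof -
  obtain f :: "real \<Rightarrow> nat set" where f: "inj f"
    using nat_sets_eqpoll_reals eqpoll_sym eqpoll_imp_lepoll unfolding lepoll_def by blast
  obtain g :: "nat set \<Rightarrow> real" where g: "inj g"
    using nat_sets_eqpoll_reals eqpoll_imp_lepoll unfolding lepoll_def by blast
  define h where "h y = g {prod_encode (n, k) | n k. k \<in> f (y n)}" for y :: "nat \<Rightarrow> real"
  have "inj h"
  proof (rule injI)
    fix y z assume "h y = h z"
    then have *: "{prod_encode (n, k) | n k. k \<in> f (y n)} = {prod_encode (n, k) | n k. k \<in> f (z n)}"
      unfolding h_def using g by (simp add: inj_eq)
    have "f (y n) = f (z n)" for n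
    proof (rule Set.set_eqI)
      fix k
      have "k \<in> f (y n) \<longleftrightarrow> prod_encode (n, k) \<in> {prod_encode (n, k) | n k. k \<in> f (y n)}" by auto
      also have "\<dots> \<longleftrightarrow> k \<in> f (z n)" unfolding * by auto
      finally show "k \<in> f (y n) \<longleftrightarrow> k \<in> f (z n)" .
    qed
    then show "y = z" using f by (auto simp: inj_eq)
  qed
  then show ?thesis unfolding lepoll_def by blast
qed

section \<open>Tsirelson's space and its dual\<close>

lemma pairing_scale_right: "pairing y (\<lambda>n. c * x n) = c * pairing y x"
  by (cases "c = 0") (simp_all add: pairing_def sum_distrib_left algebra_simps)

lemma pairing_add_right:
  assumes "finite {n. x n \<noteq> 0}" "finite {n. z n \<noteq> 0}"
  shows "pairing y (x + z) = pairing y x + pairing y z"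
proof -
  let ?S = "{n. x n \<noteq> 0} \<union> {n. z n \<noteq> 0}"
  have "pairing y w = (\<Sum>n\<in>?S. y n * w n)" if "{n. w n \<noteq> 0} \<subseteq> ?S" for w
    using that assms by (intro pairing_eq_sum) auto
  moreover have "{n. (x + z) n \<noteq> 0} \<subseteq> ?S" by auto
  ultimately show ?thesis by (simp add: sum.distrib distrib_left)
qed

lemma finite_support_add:
  "finite {n. x n \<noteq> (0::real)} \<Longrightarrow> finite {n. z n \<noteq> 0} \<Longrightarrow> finite {n::nat. (x + z) n \<noteq> 0}"
  by (rule finite_subset[of _ "{n. x n \<noteq> 0} \<union> {n. z n \<noteq> 0}"]) auto

lemma finite_support_sum_pairing:
  assumes "finite I" "\<And>i. i \<in> I \<Longrightarrow> finite {n. x i n \<noteq> 0}"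
  shows "finite {n. (\<Sum>i\<in>I. x i) n \<noteq> 0} \<and> pairing y (\<Sum>i\<in>I. x i) = (\<Sum>i\<in>I. pairing y (x i))"
  using assms
proof (induction I rule: finite_induct)
  case empty
  then show ?case by (simp add: pairing_def)
next
  case (insert i I)
  then show ?case
    using finite_support_add[of "x i" "\<Sum>i\<in>I. x i"] pairing_add_right[of "x i" "\<Sum>i\<in>I. x i" y]
    by (simp add: plus_fun_def)
qed

lemma pairing_sum: "pairing (\<Sum>i\<in>I. w i) x = (\<Sum>i\<in>I. pairing (w i) x)"
proof (induction I rule: infinite_finite_induct)
  case (infinite I)
  then show ?case using pairing_zero[of x] by (simp add: zero_fun_def)
next
  case empty
  then show ?case using pairing_zero[of x] by (simp add: zero_fun_def)
next
  case (insert i I)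
  then show ?case using pairing_add[of "w i" "sum w I" x] by (simp add: plus_fun_def)
qed

lemma pairing_cong: "(\<And>n. x n \<noteq> 0 \<Longrightarrow> y n = z n) \<Longrightarrow> pairing y x = pairing z x"
  by (simp add: pairing_def)

definition restr :: "nat \<Rightarrow> nat \<Rightarrow> (nat \<Rightarrow> real) \<Rightarrow> nat \<Rightarrow> real" where
  "restr a b y m = (if a \<le> m \<and> m < b then y m else 0)"

lemma pairing_restr: "finite {n. x n \<noteq> 0} \<Longrightarrow> pairing y (restr a b x) = pairing (restr a b y) x"
  by (subst pairing_eq_sum[of "{n. x n \<noteq> 0}" "restr a b x"])
    (auto simp: restr_def pairing_def intro!: sum.cong)

text \<open>The functional glued from \<open>f 0, \<dots>, f (n - 1)\<close> on the successive intervals with endpoints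
\<open>p 0 \<le> \<dots> \<le> p n\<close>, with Tsirelson's factor \<open>1/2\<close>.\<close>

definition admissible :: "nat \<Rightarrow> (nat \<Rightarrow> nat) \<Rightarrow> (nat \<Rightarrow> nat \<Rightarrow> real) \<Rightarrow> nat \<Rightarrow> real" where
  "admissible n p f m = (\<Sum>i<n. restr (p i) (p (Suc i)) (f i) m) / 2"

text \<open>The norming set of the Figiel-Johnson space \<open>T\<close>: its norm satisfies
\<open>\<parallel>x\<parallel> = max (sup \<bar>x\<^sub>m\<bar>) (sup (\<parallel>E\<^sub>1 x\<parallel> + \<dots> + \<parallel>E\<^sub>n x\<parallel>) / 2)\<close>, where the second supremum runs over
successive intervals \<open>E\<^sub>1 < \<dots> < E\<^sub>n\<close> that start at or after \<open>n\<close>. Admitting \<open>\<bar>s\<bar> \<le> 1\<close> instead of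
\<open>\<bar>s\<bar> = 1\<close> in the base case puts \<open>0\<close> into the set, which makes it closed under restriction.\<close>

inductive_set norming :: "(nat \<Rightarrow> real) set" where
  unit: "\<bar>s\<bar> \<le> 1 \<Longrightarrow> (\<lambda>m. if m = n then s else 0) \<in> norming"
| step: "n \<le> p 0 \<Longrightarrow> mono p \<Longrightarrow> (\<And>i. i < n \<Longrightarrow> f i \<in> norming) \<Longrightarrow> admissible n p f \<in> norming"

lemma admissible_at:
  assumes "mono p" "i < n" "p i \<le> m" "m < p (Suc i)"
  shows "admissible n p f m = f i m / 2"
proof -
  have "restr (p k) (p (Suc k)) (f k) m = (if k = i then f i m else 0)" for k
  proof (cases k i rule: linorder_cases)
    case less
    then have "p (Suc k) \<le> p i" using assms(1) by (simp add: monoD)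
    with assms less show ?thesis by (simp add: restr_def)
  next
    case greater
    then have "p (Suc i) \<le> p k" using assms(1) by (simp add: monoD)
    with assms greater show ?thesis by (simp add: restr_def)
  qed (use assms in \<open>simp add: restr_def\<close>)
  then show ?thesis using assms by (simp add: admissible_def)
qed

lemma admissible_outside:
  assumes "\<And>i. i < n \<Longrightarrow> \<not> (p i \<le> m \<and> m < p (Suc i))"
  shows "admissible n p f m = 0"
  using assms by (auto simp: admissible_def restr_def intro!: sum.neutral)

lemma norming_le_1: "f \<in> norming \<Longrightarrow> \<bar>f m\<bar> \<le> 1"
proof (induction arbitrary: m rule: norming.induct)
  case (step n p f)
  show ?case
  proof (cases "\<exists>i<n. p i \<le> m \<and> m < p (Suc i)")
    case True
    then obtain i where i: "i < n" "p i \<le> m" "m < p (Suc i)" by blast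
    show ?thesis
      using admissible_at[OF step(2) i, of f] step.IH[OF i(1), of m] by simp
  next
    case False
    then have "admissible n p f m = 0" by (intro admissible_outside) blast
    then show ?thesis by simp
  qed
qed auto

lemma uminus_norming: "f \<in> norming \<Longrightarrow> - f \<in> norming"
proof (induction rule: norming.induct)
  case (unit s n)
  have "- (\<lambda>m. if m = n then s else 0) = (\<lambda>m. if m = n then - s else 0)" by (auto simp: fun_eq_iff)
  then show ?case using norming.unit[of "- s" n] unit by simp
next
  case (step n p f)
  have "- admissible n p f = admissible n p (\<lambda>i. - f i)"
    by (auto simp: fun_eq_iff admissible_def restr_def sum_negf[symmetric] intro!: sum.cong)
  then show ?case using norming.step[of n p "\<lambda>i. - f i"] step by simp
qed

lemma restr_norming: "f \<in> norming \<Longrightarrow> restr a b f \<in> norming"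
proof (induction rule: norming.induct)
  case (unit s n)
  have "restr a b (\<lambda>m. if m = n then s else 0) = (\<lambda>m. if m = n then (if a \<le> n \<and> n < b then s else 0) else 0)"
    by (auto simp: restr_def)
  moreover have "\<bar>if a \<le> n \<and> n < b then s else 0\<bar> \<le> 1" using unit by simp
  ultimately show ?case using norming.unit by metis
next
  case (step n p f)
  have "restr a b (admissible n p f) = admissible n p (\<lambda>i. restr a b (f i))"
    by (auto simp: fun_eq_iff admissible_def restr_def intro!: sum.cong sum.neutral sum.neutral[symmetric])
  then show ?case using norming.step[of n p "\<lambda>i. restr a b (f i)"] step by simp
qed

text \<open>The finitely supported part of the unit ball of \<open>T\<close>. With these test vectors the dual norm is that of \<open>T*\<close>.\<close>

definition tsirelson_ball :: "(nat \<Rightarrow> real) set" where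
  "tsirelson_ball = {x. finite {n. x n \<noteq> 0} \<and> (\<forall>f\<in>norming. pairing f x \<le> 1)}"

lemma finite_support_ball: "x \<in> tsirelson_ball \<Longrightarrow> finite {n. x n \<noteq> 0}"
  by (simp add: tsirelson_ball_def)

interpretation tsirelson: test_set tsirelson_ball
proof
  show "- x \<in> tsirelson_ball" if "x \<in> tsirelson_ball" for x
  proof -
    have "pairing f (- x) \<le> 1" if f: "f \<in> norming" for f
      using uminus_norming[OF f] \<open>x \<in> tsirelson_ball\<close> pairing_diff[of 0 f x]
      by (auto simp: tsirelson_ball_def pairing_uminus pairing_zero)
    then show ?thesis using that by (simp add: tsirelson_ball_def)
  qed
  show "unit_seq n \<in> tsirelson_ball" for n
    using norming_le_1[of _ n] by (auto simp: tsirelson_ball_def pairing_unit_seq unit_seq_def abs_le_iff)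
qed (simp add: tsirelson_ball_def)

lemma restr_ball: "x \<in> tsirelson_ball \<Longrightarrow> restr a b x \<in> tsirelson_ball"
  unfolding tsirelson_ball_def
  by (auto simp: pairing_restr restr_norming intro: finite_subset[of "{n. restr a b x n \<noteq> 0}" "{n. x n \<noteq> 0}"])
    (auto simp: restr_def intro: finite_subset)

lemma dual_le_restr: "dual_le tsirelson_ball y c \<Longrightarrow> dual_le tsirelson_ball (restr a b y) c"
  unfolding dual_le_def
proof
  fix x assume "\<forall>x\<in>tsirelson_ball. pairing y x \<le> c" and x: "x \<in> tsirelson_ball"
  then have "pairing y (restr a b x) \<le> c" using restr_ball by blast
  then show "pairing (restr a b y) x \<le> c" by (simp add: pairing_restr[OF finite_support_ball[OF x]])
qed

text \<open>Homogeneity: after division by (slightly more than) its \<open>T\<close>-norm, \<open>x\<close> is a test vector, so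
\<open>\<langle>u, x\<rangle>\<close> is at most \<open>L\<close> times that norm, and the norm is almost attained on \<open>norming\<close>.\<close>

lemma norming_approx:
  assumes u: "dual_le tsirelson_ball u L" and x: "finite {n. x n \<noteq> 0}" and "d > 0"
  shows "\<exists>f\<in>norming. pairing u x \<le> L * (pairing f x + d)"
proof -
  have L: "L \<ge> 0" using tsirelson.dual_le_nonneg u by blast
  have bdd: "bdd_above ((\<lambda>f. pairing f x) ` norming)"
  proof (rule bdd_aboveI2)
    show "pairing f x \<le> (\<Sum>n | x n \<noteq> 0. \<bar>x n\<bar>)" if "f \<in> norming" for f
      unfolding pairing_def
    proof (rule sum_mono)
      fix n
      have "f n * x n \<le> \<bar>f n\<bar> * \<bar>x n\<bar>" by (metis abs_ge_self abs_mult)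
      also have "\<dots> \<le> 1 * \<bar>x n\<bar>" by (intro mult_right_mono norming_le_1 that) auto
      finally show "f n * x n \<le> \<bar>x n\<bar>" by simp
    qed
  qed
  define t where "t = (SUP f\<in>norming. pairing f x)"
  have zero: "(\<lambda>m. if m = 0 then 0 else 0) \<in> norming" using norming.unit[of 0 0] by simp
  have up: "pairing f x \<le> t" if "f \<in> norming" for f
    unfolding t_def by (rule cSUP_upper[OF that bdd])
  have "t \<ge> 0" using up[OF zero] by (simp add: pairing_def)
  define c where "c = t + d / 2"
  have c: "c > 0" using \<open>t \<ge> 0\<close> \<open>d > 0\<close> by (simp add: c_def)
  have "pairing f (\<lambda>n. (1 / c) * x n) \<le> 1" if "f \<in> norming" for f
    using up[OF that] c \<open>d > 0\<close> unfolding pairing_scale_right by (simp add: c_def)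
  then have "(\<lambda>n. (1 / c) * x n) \<in> tsirelson_ball"
    using x c by (simp add: tsirelson_ball_def)
  then have "(1 / c) * pairing u x \<le> L"
    using u unfolding dual_le_def by (metis pairing_scale_right)
  then have ux: "pairing u x \<le> L * c" using c by (simp add: field_simps)
  obtain f where f: "f \<in> norming" "t - d / 2 < pairing f x"
    using less_cSUP_iff[OF _ bdd, of "t - d / 2"] zero \<open>d > 0\<close> by (auto simp: t_def)
  have "L * c \<le> L * (pairing f x + d)" using f(2) L by (intro mult_left_mono) (auto simp: c_def)
  with ux f(1) show ?thesis by force
qed

text \<open>Sums of \<open>j\<close> successive blocks of norm at most \<open>L\<close>, supported between \<open>k\<close> and \<open>q\<close>. The endpoint
\<open>q\<close> is recorded so that further blocks can be appended.\<close>

definition blocks :: "nat \<Rightarrow> real \<Rightarrow> nat \<Rightarrow> nat \<Rightarrow> (nat \<Rightarrow> real) \<Rightarrow> bool" where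
  "blocks k L j q b \<longleftrightarrow> (\<exists>p u. mono p \<and> k \<le> p 0 \<and> p j = q \<and> b = (\<Sum>i<j. u i) \<and>
     (\<forall>i<j. dual_le tsirelson_ball (u i) L \<and> restr (p i) (p (Suc i)) (u i) = u i))"

lemma blocks_0: "blocks k L 0 k 0"
  unfolding blocks_def by (intro exI[of _ "\<lambda>_. k"]) (auto simp: mono_def)

lemma blocks_Suc:
  assumes "blocks k L j q b" "q \<le> q'" "dual_le tsirelson_ball u L" "restr q q' u = u"
  shows "blocks k L (Suc j) q' (b + u)"
proof -
  obtain p v where p: "mono p" "k \<le> p 0" "p j = q" "b = (\<Sum>i<j. v i)"
    "\<And>i. i < j \<Longrightarrow> dual_le tsirelson_ball (v i) L \<and> restr (p i) (p (Suc i)) (v i) = v i"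
    using assms(1) unfolding blocks_def by blast
  let ?p = "\<lambda>i. if i \<le> j then p i else q'" and ?v = "v(j := u)"
  have "p i \<le> q'" if "i \<le> j" for i
    using monoD[OF p(1) that] p(3) assms(2) by simp
  then have "mono ?p" using p(1) by (auto simp: mono_def)
  moreover have "b + u = (\<Sum>i<Suc j. ?v i)" using p(4) by simp
  moreover have "dual_le tsirelson_ball (?v i) L \<and> restr (?p i) (?p (Suc i)) (?v i) = ?v i" if "i < Suc j" for i
    using that p(3,5) assms by (cases "i = j") auto
  ultimately show ?thesis
    unfolding blocks_def using p(2) by (intro exI[of _ ?p] exI[of _ ?v]) auto
qed

text \<open>\<open>T*\<close> is asymptotically \<open>c\<^sub>0\<close>. Dually, \<open>T\<close> satisfies \<open>\<parallel>E\<^sub>1 x\<parallel> + \<dots> + \<parallel>E\<^sub>j x\<parallel> \<le> 2 \<parallel>x\<parallel>\<close> when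
\<open>j \<le> k \<le> E\<^sub>1\<close>, because functionals that norm the pieces can be glued to one in \<open>norming\<close>. The
third \<open>L\<close> pays for choosing them only approximately.\<close>

lemma dual_le_blocks:
  assumes "blocks k L j q b" "j \<le> k" and L: "L \<ge> 0"
  shows "dual_le tsirelson_ball b (3 * L)"
  unfolding dual_le_def
proof
  fix x assume x: "x \<in> tsirelson_ball"
  then have fin: "finite {n. x n \<noteq> 0}" by (rule finite_support_ball)
  obtain p u where p: "mono p" "k \<le> p 0" "p j = q" "b = (\<Sum>i<j. u i)"
    "\<And>i. i < j \<Longrightarrow> dual_le tsirelson_ball (u i) L"
    "\<And>i. i < j \<Longrightarrow> restr (p i) (p (Suc i)) (u i) = u i"
    using assms(1) unfolding blocks_def by blast
  define d where "d = 1 / (real j + 1)"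
  have d: "d > 0" "real j * d \<le> 1" by (auto simp: d_def)
  let ?x = "\<lambda>i. restr (p i) (p (Suc i)) x"
  have "\<exists>f\<in>norming. pairing (u i) (?x i) \<le> L * (pairing f (?x i) + d)" if "i < j" for i
    by (rule norming_approx[OF p(5)[OF that] finite_support_ball[OF restr_ball[OF x]] d(1)])
  then obtain f where f: "\<And>i. i < j \<Longrightarrow> f i \<in> norming"
    "\<And>i. i < j \<Longrightarrow> pairing (u i) (?x i) \<le> L * (pairing (f i) (?x i) + d)" by metis
    have lin: "pairing (\<Sum>i<j. w i) x = (\<Sum>i<j. pairing (w i) x)" for w :: "nat \<Rightarrow> nat \<Rightarrow> real"
      by (rule pairing_sum)
    have "pairing b x = (\<Sum>i<j. pairing (u i) x)"
      unfolding p(4) by (rule lin)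
    also have "\<dots> \<le> (\<Sum>i<j. L * (pairing (f i) (?x i) + d))"
      using f(2) p(6) by (intro sum_mono) (simp add: pairing_restr[OF fin])
    also have "\<dots> = L * ((\<Sum>i<j. pairing (f i) (?x i)) + real j * d)"
      by (simp add: sum_distrib_left sum.distrib algebra_simps)
    also have "(\<Sum>i<j. pairing (f i) (?x i)) = pairing (\<Sum>i<j. restr (p i) (p (Suc i)) (f i)) x"
      by (simp add: lin pairing_restr[OF fin])
    also have "(\<Sum>i<j. restr (p i) (p (Suc i)) (f i)) = (\<lambda>m. 2 * admissible j p f m)"
      by (auto simp: admissible_def fun_eq_iff) (induction j; simp)
    also have "pairing (\<lambda>m. 2 * admissible j p f m) x = 2 * pairing (admissible j p f) x"
      by (rule pairing_scale)
    also have "L * (2 * pairing (admissible j p f) x + real j * d) \<le> L * (2 * 1 + 1)"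
    proof (intro mult_left_mono add_mono L d)
      have "admissible j p f \<in> norming" using assms(2) p(1,2) f(1) by (intro norming.step) auto
      then show "pairing (admissible j p f) x \<le> 1" using x by (simp add: tsirelson_ball_def)
    qed auto
    finally show "pairing b x \<le> 3 * L" by simp
qed

text \<open>If no endpoint \<open>p i\<close> cuts the support of \<open>x\<close>, the glued functional acts on \<open>x\<close> as half of a
single norming functional.\<close>

lemma pairing_admissible_block:
  assumes x: "x \<in> tsirelson_ball" "restr a b x = x"
    and p: "mono p" "\<And>i. i < n \<Longrightarrow> f i \<in> norming" and uncut: "\<And>i. i \<le> n \<Longrightarrow> \<not> (a < p i \<and> p i < b)"
  shows "pairing (admissible n p f) x \<le> 1 / 2"
proof (cases "\<exists>i<n. p i \<le> a \<and> a < p (Suc i)")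
  case True
  then obtain i where i: "i < n" "p i \<le> a" "a < p (Suc i)" by blast
  have "admissible n p f m = (1 / 2) * f i m" if "x m \<noteq> 0" for m
  proof -
    have "a \<le> m" "m < b" using x(2) that by (auto simp: restr_def fun_eq_iff) metis+
    then show ?thesis using uncut[of "Suc i"] i admissible_at[OF p(1) i(1), of m f] by auto
  qed
  then have "pairing (admissible n p f) x = (1 / 2) * pairing (f i) x"
    unfolding pairing_scale[symmetric] by (rule pairing_cong)
  then show ?thesis using x(1) p(2)[OF i(1)] by (simp add: tsirelson_ball_def)
next
  case False
  have "admissible n p f m = 0 m" if "x m \<noteq> 0" for m
  proof -
    have m: "a \<le> m" "m < b" using x(2) that by (auto simp: restr_def fun_eq_iff) metis+
    have "admissible n p f m = 0"
    proof (rule admissible_outside)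
      fix i assume "i < n"
      then show "\<not> (p i \<le> m \<and> m < p (Suc i))"
        using False m uncut[of i] by (cases "p i \<le> a") force+
    qed
    then show ?thesis by simp
  qed
  then have "pairing (admissible n p f) x = pairing 0 x" by (rule pairing_cong)
  then show ?thesis by (simp add: pairing_zero)
qed

text \<open>At most one block is cut by each of the \<open>n + 1\<close> endpoints. Cut blocks contribute at most \<open>1\<close>, all
others at most \<open>1/2\<close>.\<close>

lemma pairing_admissible_blocks:
  assumes x: "\<And>l. l < r \<Longrightarrow> x l \<in> tsirelson_ball" "\<And>l. l < r \<Longrightarrow> restr (t l) (t (Suc l)) (x l) = x l"
    and t: "mono t" and p: "n \<le> p 0" "mono p" "\<And>i. i < n \<Longrightarrow> f i \<in> norming"
  shows "(\<Sum>l<r. pairing (admissible n p f) (x l)) \<le> (real r + real n + 1) / 2"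
proof -
  define cut where "cut = {l. l < r \<and> (\<exists>i\<le>n. t l < p i \<and> p i < t (Suc l))}"
  have "\<forall>l\<in>cut. \<exists>i\<le>n. t l < p i \<and> p i < t (Suc l)" by (auto simp: cut_def)
  then obtain c where c: "\<And>l. l \<in> cut \<Longrightarrow> c l \<le> n \<and> t l < p (c l) \<and> p (c l) < t (Suc l)" by metis
  have "inj_on c cut"
  proof (rule linorder_inj_onI)
    fix l l' assume l: "l < l'" "l \<in> cut" "l' \<in> cut"
    then have "p (c l) < t (Suc l)" "t (Suc l) \<le> t l'" "t l' < p (c l')"
      using c[of l] c[of l'] monoD[OF t, of "Suc l" l'] by auto
    then show "c l \<noteq> c l'" by force
  qed auto
  moreover have "c ` cut \<subseteq> {..n}" using c by auto
  ultimately have "card cut \<le> card {..n}" by (intro card_inj_on_le) auto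
  then have card: "card cut \<le> n + 1" by simp
  have "cut \<subseteq> {..<r}" by (auto simp: cut_def)
  have "pairing (admissible n p f) (x l) \<le> 1 / 2 + (if l \<in> cut then 1 / 2 else 0)" if "l < r" for l
  proof (cases "l \<in> cut")
    case True
    then show ?thesis
      using x(1)[OF that] norming.step[of n p f] p by (simp add: tsirelson_ball_def)
  next
    case False
    then show ?thesis
      using that pairing_admissible_block[OF x(1)[OF that] x(2)[OF that] p(2), of n f] p(3)
      by (auto simp: cut_def)
  qed
  then have "(\<Sum>l<r. pairing (admissible n p f) (x l)) \<le> (\<Sum>l<r. 1 / 2 + (if l \<in> cut then 1 / 2 else 0))"
    by (intro sum_mono) auto
  also have "\<dots> = real r / 2 + real (card cut) / 2"
    using \<open>cut \<subseteq> {..<r}\<close> by (simp add: sum.distrib sum.If_cases Int_absorb1)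
  also have "\<dots> \<le> (real r + real n + 1) / 2" using card by simp
  finally show ?thesis .
qed

definition tail :: "nat \<Rightarrow> (nat \<Rightarrow> real) \<Rightarrow> nat \<Rightarrow> real" where
  "tail q y m = (if q \<le> m then y m else 0)"

lemma restr_tail:
  assumes "finite {n. x n \<noteq> 0}"
  obtains b where "tail q x = restr q b x" "q \<le> b"
proof -
  obtain b where "\<forall>n\<in>{n. x n \<noteq> 0}. n < b" using assms finite_nat_set_iff_bounded by blast
  then have "tail q x = restr q (max q b) x" by (auto simp: tail_def restr_def fun_eq_iff)
  then show thesis using that by simp
qed

lemma restr_restr: "restr a b (restr a b y) = restr a b y"
  by (simp add: restr_def fun_eq_iff)

text \<open>Vectors on which \<open>y\<close> is at least \<open>s\<close> are closed under averages. The average of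
\<open>r = 8 (q + 1)\<close> successive ones is seen by a glued functional with at most \<open>q\<close> pieces
with value at most \<open>1/2 + (q + 1) / (2 r) = 9/16\<close>.\<close>

lemma fast_average:
  assumes mem: "\<And>n. \<exists>x N. n \<le> N \<and> x \<in> tsirelson_ball \<and> restr n N x = x \<and> s \<le> pairing y x"
  shows "\<exists>x N. n \<le> N \<and> x \<in> tsirelson_ball \<and> restr n N x = x \<and> s \<le> pairing y x \<and>
    (\<forall>k p f. k \<le> q \<longrightarrow> k \<le> p 0 \<longrightarrow> mono p \<longrightarrow> (\<forall>i<k. f i \<in> norming) \<longrightarrow>
       pairing (admissible k p f) x \<le> 9 / 16)"
proof -
  obtain v N where v: "\<And>n. n \<le> N n" "\<And>n. v n \<in> tsirelson_ball" "\<And>n. restr n (N n) (v n) = v n"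
    "\<And>n. s \<le> pairing y (v n)" using mem by metis
  define t where "t = rec_nat n (\<lambda>_. N)"
  define x where "x l = v (t l)" for l
  define r where "r = 8 * (q + 1)"
  have r: "r > 0" by (simp add: r_def)
  have t: "t 0 = n" "t (Suc l) = N (t l)" for l by (simp_all add: t_def)
  have "mono t" by (intro incseq_SucI) (simp add: t v)
  have x: "x l \<in> tsirelson_ball" "restr (t l) (t (Suc l)) (x l) = x l" "s \<le> pairing y (x l)" for l
    using v by (simp_all add: x_def t)
  define z where "z m = (1 / real r) * (\<Sum>l<r. x l) m" for m
  have fin: "finite {n. x l n \<noteq> 0}" for l using x(1) by (rule finite_support_ball)
  have pz: "pairing w z = (1 / real r) * (\<Sum>l<r. pairing w (x l))" for w
    unfolding z_def pairing_scale_right using finite_support_sum_pairing[of "{..<r}" x] fin by simp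
  have "finite {m. z m \<noteq> 0}"
    by (rule finite_subset[of _ "{m. (\<Sum>l<r. x l) m \<noteq> 0}"])
      (use finite_support_sum_pairing[of "{..<r}" x] fin in \<open>auto simp: z_def\<close>)
  moreover have "pairing f z \<le> 1" if f: "f \<in> norming" for f
  proof -
    have "(\<Sum>l<r. pairing f (x l)) \<le> (\<Sum>l<r. 1)"
      using x(1) f by (intro sum_mono) (simp add: tsirelson_ball_def)
    then show ?thesis using r by (simp add: pz)
  qed
  ultimately have "z \<in> tsirelson_ball" by (simp add: tsirelson_ball_def)
  moreover have "restr n (t r) z = z"
  proof
    fix m
    show "restr n (t r) z m = z m"
    proof (cases "n \<le> m \<and> m < t r")
      case False
      have "x l m = 0" if "l < r" for l
      proof -
        have "t 0 \<le> t l" "t (Suc l) \<le> t r" using \<open>mono t\<close> that by (auto simp: mono_def)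
        then have "\<not> (t l \<le> m \<and> m < t (Suc l))" using False t(1) by auto
        then show ?thesis using x(2)[of l] by (metis restr_def)
      qed
      moreover have "(\<Sum>l<r. x l) m = (\<Sum>l<r. x l m)" by (induction r) auto
      ultimately show ?thesis using False by (simp add: restr_def z_def)
    qed (simp add: restr_def)
  qed
  moreover have "s \<le> pairing y z"
  proof -
    have "(\<Sum>l<r. s) \<le> (\<Sum>l<r. pairing y (x l))" using x(3) by (intro sum_mono)
    then show ?thesis using r by (simp add: pz field_simps)
  qed
  moreover have "pairing (admissible k p f) z \<le> 9 / 16"
    if "k \<le> q" "k \<le> p 0" "mono p" "\<forall>i<k. f i \<in> norming" for k p f
  proof -
    have "(\<Sum>l<r. pairing (admissible k p f) (x l)) \<le> (real r + real k + 1) / 2"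
      using x \<open>mono t\<close> that by (intro pairing_admissible_blocks) auto
    also have "\<dots> \<le> (real r + real q + 1) / 2" using that(1) by simp
    also have "\<dots> = (9 / 16) * real r" by (simp add: r_def)
    finally show ?thesis using r by (simp add: pz field_simps)
  qed
  moreover have "n \<le> t r" using \<open>mono t\<close> t(1) by (metis le0 monoD)
  ultimately show ?thesis by blast
qed

text \<open>Let \<open>x\<^sub>0\<close> be supported below \<open>q\<close> and let \<open>x\<^sub>1\<close>, supported beyond \<open>q\<close>, be a fast average for \<open>q\<close>. A
glued functional that sees \<open>x\<^sub>0\<close> starts before \<open>q\<close>, hence has fewer than \<open>q\<close> pieces and is at
most \<open>9/16\<close> on \<open>x\<^sub>1\<close>. So the mean of \<open>x\<^sub>0\<close> and \<open>x\<^sub>1\<close> has \<open>T\<close>-norm at most \<open>(1 + 9/16) / 2 < 1\<close>.\<close>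

lemma half_average:
  assumes mem: "\<And>n. \<exists>x N. n \<le> N \<and> x \<in> tsirelson_ball \<and> restr n N x = x \<and> s \<le> pairing y x"
  shows "\<exists>x. finite {m. x m \<noteq> 0} \<and> tail n x = x \<and> s \<le> pairing y x \<and>
    (\<forall>f\<in>norming. pairing f x \<le> 25 / 32)"
proof -
  obtain x0 q where x0: "n \<le> q" "x0 \<in> tsirelson_ball" "restr n q x0 = x0" "s \<le> pairing y x0"
    using mem by blast
  obtain x1 N where x1: "q \<le> N" "x1 \<in> tsirelson_ball" "restr q N x1 = x1" "s \<le> pairing y x1"
    "\<And>k p f. k \<le> q \<Longrightarrow> k \<le> p 0 \<Longrightarrow> mono p \<Longrightarrow> (\<forall>i<k. f i \<in> norming) \<Longrightarrow>
       pairing (admissible k p f) x1 \<le> 9 / 16"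
    using fast_average[OF mem, of q q] by metis
  define z where "z m = (1 / 2) * (x0 + x1) m" for m
  have fin: "finite {m. x0 m \<noteq> 0}" "finite {m. x1 m \<noteq> 0}"
    using x0 x1 finite_support_ball by auto
  have pz: "pairing w z = (pairing w x0 + pairing w x1) / 2" for w
  proof -
    have "pairing w z = (1 / 2) * pairing w (x0 + x1)"
      using pairing_scale_right[of w "1 / 2" "x0 + x1"] unfolding z_def[abs_def] .
    then show ?thesis by (simp only: pairing_add_right[OF fin])
  qed
  have x0_0: "x0 m = 0" if "m < n \<or> q \<le> m" for m
    using x0(3) that by (metis restr_def leD)
  have x1_0: "x1 m = 0" if "m < q" for m
    using x1(3) that by (metis restr_def leD)
  have "finite {m. z m \<noteq> 0}"
    by (rule finite_subset[OF _ finite_support_add[OF fin]]) (auto simp: z_def)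
  moreover have "tail n z = z"
    using x0_0 x1_0 x0(1) by (auto simp: tail_def z_def fun_eq_iff)
  moreover have "s \<le> pairing y z" using x0(4) x1(4) by (simp add: pz)
  moreover have "pairing f z \<le> 25 / 32" if "f \<in> norming" for f
    using that
  proof cases
    case (unit a m)
    have f: "pairing f w = a * w m" if "finite {k. w k \<noteq> 0}" for w
    proof -
      have "pairing f w = (\<Sum>k\<in>{k. w k \<noteq> 0}. if k = m then a * w m else 0)"
        unfolding pairing_def unit(1) by (intro sum.cong) auto
      then show ?thesis using that by (auto simp: sum.delta)
    qed
    have "a * x0 m \<le> 1" "a * x1 m \<le> 1"
      using f[OF fin(1)] f[OF fin(2)] x0(2) x1(2) that by (auto simp: tsirelson_ball_def)
    moreover have "x0 m = 0 \<or> x1 m = 0" using x0_0[of m] x1_0[of m] by force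
    ultimately show ?thesis by (auto simp: pz f[OF fin(1)] f[OF fin(2)])
  next
    case (step k p g)
    then have f_le: "pairing f x0 \<le> 1" "pairing f x1 \<le> 1"
      using x0 x1 that by (auto simp: tsirelson_ball_def)
    show ?thesis
    proof (cases "q \<le> p 0")
      case True
      have "pairing f x0 = pairing 0 x0"
      proof (rule pairing_cong)
        fix m assume "x0 m \<noteq> 0"
        then have "m < p 0" using x0_0[of m] True by force
        then have "\<not> (p i \<le> m)" for i using step(3) by (meson le0 leD le_less_trans monoD)
        then show "f m = 0 m" unfolding step(1) by (subst admissible_outside) auto
      qed
      then show ?thesis using f_le by (simp add: pz pairing_zero)
    next
      case False
      then have "pairing f x1 \<le> 9 / 16"
        unfolding step(1) using step by (intro x1(5)) auto
      then show ?thesis using f_le by (simp add: pz)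
    qed
  qed
  ultimately show ?thesis by blast
qed

lemma pairing_tail: "finite {n. x n \<noteq> 0} \<Longrightarrow> pairing (tail q y) x = pairing y (tail q x)"
  by (subst pairing_eq_sum[of "{n. x n \<noteq> 0}" "tail q x"])
    (auto simp: tail_def pairing_def intro!: sum.cong)

text \<open>\<open>T\<close> contains no \<open>\<ell>\<^sub>1\<close>, equivalently \<open>T*\<close> contains no \<open>c\<^sub>0\<close>. If the norms of the tails of \<open>y\<close>
decreased to \<open>a > 0\<close>, there would be test vectors arbitrarily far out on which \<open>y\<close> is almost \<open>a\<close>.
By \<open>half_average\<close> a mean of two of them has \<open>T\<close>-norm at most \<open>25/32\<close>, and then \<open>y\<close> is at most about
\<open>25/32 a\<close> on it.\<close>

lemma tail_small:
  assumes y: "y \<in> dual_carrier tsirelson_ball" and "\<eta> > 0"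
  shows "\<exists>q. dual_le tsirelson_ball (tail q y) \<eta>"
proof (rule ccontr)
  assume none: "\<nexists>q. dual_le tsirelson_ball (tail q y) \<eta>"
  define C where "C = {c. \<exists>q. dual_le tsirelson_ball (tail q y) c}"
  define a where "a = Inf C"
  have lower: "\<eta> \<le> c" if "c \<in> C" for c
    using that none tsirelson.dual_le_mono[of _ c \<eta>] by (auto simp: C_def) force
  have "C \<noteq> {}"
  proof -
    have "tail 0 y = y" by (simp add: tail_def fun_eq_iff)
    then show ?thesis using y by (auto simp: C_def dual_carrier_def) metis
  qed
  have "a \<ge> \<eta>" unfolding a_def using lower \<open>C \<noteq> {}\<close> by (intro cInf_greatest)
  then have "a > 0" using \<open>\<eta> > 0\<close> by simp
  obtain c n where c: "dual_le tsirelson_ball (tail n y) c" "c < 11 / 10 * a"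
  proof -
    have "Inf C < 11 / 10 * a" using \<open>a > 0\<close> by (simp add: a_def)
    then show thesis using cInf_lessD[OF \<open>C \<noteq> {}\<close>] that unfolding C_def by blast
  qed
  have mem: "\<exists>x N. k \<le> N \<and> x \<in> tsirelson_ball \<and> restr k N x = x \<and> 9 / 10 * a \<le> pairing y x" for k
  proof -
    have "9 / 10 * a \<notin> C"
    proof
      assume "9 / 10 * a \<in> C"
      then have "a \<le> 9 / 10 * a" unfolding a_def using lower by (intro cInf_lower bdd_belowI)
      then show False using \<open>a > 0\<close> by simp
    qed
    then obtain x where x: "x \<in> tsirelson_ball" "9 / 10 * a < pairing (tail k y) x"
      by (auto simp: C_def dual_le_def not_le)
    obtain N where N: "tail k x = restr k N x" "k \<le> N"
      using restr_tail[OF finite_support_ball[OF x(1)]] .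
    then show ?thesis
      using x restr_ball[OF x(1), of k N] pairing_tail[OF finite_support_ball[OF x(1)], of k y]
      by (intro exI[of _ "restr k N x"] exI[of _ N]) (simp add: restr_restr)
  qed
  obtain z where z: "finite {m. z m \<noteq> 0}" "tail n z = z" "9 / 10 * a \<le> pairing y z"
    "\<And>f. f \<in> norming \<Longrightarrow> pairing f z \<le> 25 / 32"
    using half_average[of "9 / 10 * a" y n] mem by metis
  have "(\<lambda>m. (32 / 25) * z m) \<in> tsirelson_ball"
    using z(1,4) unfolding tsirelson_ball_def mem_Collect_eq pairing_scale_right by fastforce
  then have "(32 / 25) * pairing (tail n y) z \<le> c"
    using c(1) unfolding dual_le_def by (metis pairing_scale_right)
  then have "(32 / 25) * pairing y z \<le> c" using z(1,2) by (simp add: pairing_tail)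
  then show False using z(3) c(2) \<open>a > 0\<close> by simp
qed

section \<open>Concentration of maps from trees into the dual of Tsirelson space\<close>

abbreviation "tsirelson_le \<equiv> dual_le tsirelson_ball"

text \<open>One subsequence serves all \<open>m\<close> and all coordinates \<open>l\<close>, since a countable product of compact
intervals is sequentially compact.\<close>

lemma diagonal_limits:
  fixes f :: "nat list \<Rightarrow> nat \<Rightarrow> real"
  assumes "\<And>m a b l. \<bar>f (m @ [a]) l - f (m @ [b]) l\<bar> \<le> L"
  shows "\<exists>r f'. strict_mono (r :: nat \<Rightarrow> nat) \<and> (\<forall>m l. (\<lambda>i. f (m @ [r i]) l) \<longlonglongrightarrow> f' m l)"
proof -
  define v where "v i = (\<lambda>(m, l). f (m @ [i]) l)" for i
  define S where "S = Pi\<^sub>E UNIV (\<lambda>(m, l). cball (f (m @ [0]) l) L)"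
  have "compactin (product_topology (\<lambda>_. euclidean) UNIV) S"
    unfolding S_def by (subst compactin_PiE) auto
  then have "compact S" by (simp add: euclidean_product_topology)
  then have "seq_compact S" by (rule compact_imp_seq_compact)
  moreover have "\<forall>i. v i \<in> S"
    using assms by (auto simp: v_def S_def dist_real_def)
  ultimately obtain l r where r: "strict_mono (r :: nat \<Rightarrow> nat)" "(v \<circ> r) \<longlonglongrightarrow> l"
    by (rule seq_compactE)
  have "(\<lambda>i. f (m @ [r i]) k) \<longlonglongrightarrow> l (m, k)" for m k
  proof -
    have "(\<lambda>i. (v \<circ> r) i (m, k)) \<longlonglongrightarrow> l (m, k)"
      by (rule continuous_on_tendsto_compose[OF continuous_on_product_coordinates r(2)]) auto
    then show ?thesis by (simp add: v_def)
  qed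
  then show ?thesis using r(1) by (intro exI[of _ r] exI[of _ "\<lambda>m k. l (m, k)"]) simp
qed

lemma tsirelson_ball_coord: "x \<in> tsirelson_ball \<Longrightarrow> \<bar>x n\<bar> \<le> 1"
proof -
  assume x: "x \<in> tsirelson_ball"
  have "s * x n \<le> 1" if "\<bar>s\<bar> \<le> 1" for s
  proof -
    have "pairing (\<lambda>m. if m = n then s else 0) x = (\<Sum>k\<in>{k. x k \<noteq> 0}. if k = n then s * x n else 0)"
      unfolding pairing_def by (intro sum.cong) auto
    also have "\<dots> = s * x n" using finite_support_ball[OF x] by (auto simp: sum.delta)
    finally have "pairing (\<lambda>m. if m = n then s else 0) x = s * x n" .
    moreover have "pairing (\<lambda>m. if m = n then s else 0) x \<le> 1"
      using x norming.unit[OF that, of n] unfolding tsirelson_ball_def by blast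
    ultimately show ?thesis by simp
  qed
  from this[of 1] this[of "-1"] show ?thesis by simp
qed

lemma tsirelson_le_restr_sum: "tsirelson_le (restr 0 q y) (\<Sum>l<q. \<bar>y l\<bar>)"
  unfolding dual_le_def
proof
  fix x assume x: "x \<in> tsirelson_ball"
  have "pairing (restr 0 q y) x = (\<Sum>l\<in>{n. x n \<noteq> 0} \<union> {..<q}. restr 0 q y l * x l)"
    using finite_support_ball[OF x] by (intro pairing_eq_sum) auto
  also have "\<dots> = (\<Sum>l<q. y l * x l)"
    using finite_support_ball[OF x] by (intro sum.mono_neutral_cong_right) (auto simp: restr_def)
  also have "\<dots> \<le> (\<Sum>l<q. \<bar>y l\<bar>)"
  proof (rule sum_mono)
    fix l
    have "y l * x l \<le> \<bar>y l\<bar> * \<bar>x l\<bar>" by (metis abs_ge_self abs_mult)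
    also have "\<dots> \<le> \<bar>y l\<bar> * 1" by (intro mult_left_mono tsirelson_ball_coord x) auto
    finally show "y l * x l \<le> \<bar>y l\<bar>" by simp
  qed
  finally show "pairing (restr 0 q y) x \<le> (\<Sum>l<q. \<bar>y l\<bar>)" .
qed

lemma tsirelson_le_tail_mono:
  assumes "tsirelson_le (tail q y) c" "q \<le> q'"
  shows "tsirelson_le (tail q' y) c"
  unfolding dual_le_def
proof
  fix x assume x: "x \<in> tsirelson_ball"
  then have fin: "finite {n. x n \<noteq> 0}" by (rule finite_support_ball)
  obtain b where b: "tail q' x = restr q' b x" using restr_tail[OF fin] by metis
  have "pairing (tail q' y) x = pairing (tail q y) (tail q' x)"
    using assms(2) by (simp add: pairing_tail[OF fin]) (auto simp: pairing_def tail_def intro!: sum.cong)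
  also have "\<dots> \<le> c" unfolding b using restr_ball[OF x] assms(1) by (simp add: dual_le_def)
  finally show "pairing (tail q' y) x \<le> c" .
qed

text \<open>The vertices of a cube, of dimension the length of \<open>ps\<close>, inside the tree of all tuples.\<close>

abbreviation selects :: "nat list \<Rightarrow> (nat \<times> nat) list \<Rightarrow> bool" where
  "selects m ps \<equiv> list_all2 (\<lambda>x p. x = fst p \<or> x = snd p) m ps"

lemma finite_selects: "finite {m. selects m ps}"
proof (rule finite_subset)
  show "{m. selects m ps} \<subseteq> {m. set m \<subseteq> fst ` set ps \<union> snd ` set ps \<and> length m = length ps}"
    by (force simp: list_all2_conv_all_nth in_set_conv_nth)
qed (rule finite_lists_length_eq, simp)

text \<open>By induction on \<open>n\<close>. The limit \<open>f' m\<close> of \<open>f (m @ [i])\<close> along a subsequence of values of \<open>i\<close>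
inherits the Lipschitz condition, so the induction hypothesis applies to it. The increments
\<open>f (m @ [i]) - f' m\<close> are bounded by \<open>L\<close> and tend to zero in each coordinate; for \<open>i\<close> far out they are
small below \<open>q\<close>, and their tails are small, so they are close to one more block beyond \<open>q\<close>. Only
finitely many tuples \<open>m\<close> are involved, so two values of \<open>i\<close> can be chosen for all of them at once.\<close>

lemma tree_approximation:
  fixes f :: "nat list \<Rightarrow> nat \<Rightarrow> real"
  assumes "\<And>m. f m \<in> dual_carrier tsirelson_ball"
    and "\<And>m a b m'. tsirelson_le (f (m @ a # m') - f (m @ b # m')) L"
  shows "\<exists>g. \<forall>\<eta>>0. \<forall>k. \<exists>ps q. length ps = n \<and> (\<forall>p\<in>set ps. fst p \<noteq> snd p) \<and>
    (\<forall>m. selects m ps \<longrightarrow> (\<exists>b. blocks k L n q b \<and> tsirelson_le (f m - g - b) (real n * \<eta>)))"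
  using assms
proof (induction n arbitrary: f)
  case 0
  have "tsirelson_le 0 0" by (simp add: dual_le_def pairing_zero)
  then have "blocks k L 0 k 0 \<and> tsirelson_le (f [] - f [] - 0) (real 0 * \<eta>)" for k \<eta>
    by (simp add: blocks_0 del: minus_apply zero_fun_apply)
  then have *: "length [] = 0 \<and> (\<forall>p\<in>set []. fst p \<noteq> snd p) \<and> (\<forall>m. selects m [] \<longrightarrow>
      (\<exists>b. blocks k L 0 k b \<and> tsirelson_le (f m - f [] - b) (real 0 * \<eta>)))" for k \<eta>
    by (intro conjI allI impI exI[of _ 0]) (auto simp del: minus_apply zero_fun_apply)
  show ?case
    by (rule exI[of _ "f []"], intro allI impI, rule exI[of _ "[]"], rule exI, rule *)
next
  case (Suc n)
  note mem = Suc.prems(1) and lip = Suc.prems(2)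
  have last: "tsirelson_le (f (m @ [a]) - f (m @ [b])) L" for m a b
    using lip[of m a "[]" b] .
  have "\<bar>f (m @ [a]) l - f (m @ [b]) l\<bar> \<le> L" for m a b l
    using tsirelson.dual_le_coord[OF last[of m a b], of l] by simp
  then obtain r f' where r: "strict_mono (r :: nat \<Rightarrow> nat)"
    and f': "\<And>m l. (\<lambda>i. f (m @ [r i]) l) \<longlonglongrightarrow> f' m l"
    using diagonal_limits[of f L] by blast
  have diff: "tsirelson_le (f (m @ [c]) - f' m) L" for m c
  proof (rule tsirelson.dual_le_lim)
    show "(\<lambda>i. (f (m @ [c]) - f (m @ [r i])) l) \<longlonglongrightarrow> (f (m @ [c]) - f' m) l" for l
      using f' by (auto intro: tendsto_intros)
  qed (rule last)
  have mem': "f' m \<in> dual_carrier tsirelson_ball" for m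
  proof -
    have "f (m @ [0]) - (f (m @ [0]) - f' m) \<in> dual_carrier tsirelson_ball"
      by (intro tsirelson.dual_carrier_diff mem tsirelson.dual_carrierI[OF diff])
    then show ?thesis by (simp del: minus_apply)
  qed
  have lip': "tsirelson_le (f' (m @ a # m') - f' (m @ b # m')) L" for m a b m'
  proof (rule tsirelson.dual_le_lim)
    show "(\<lambda>i. (f ((m @ a # m') @ [r i]) - f ((m @ b # m') @ [r i])) l)
        \<longlonglongrightarrow> (f' (m @ a # m') - f' (m @ b # m')) l" for l
      using f' by (auto intro!: tendsto_diff simp del: append_assoc)
    show "tsirelson_le (f ((m @ a # m') @ [r i]) - f ((m @ b # m') @ [r i])) L" for i
      using lip[of m a "m' @ [r i]" b] by (simp del: minus_apply)
  qed
  obtain g where g: "\<And>\<eta> k. \<eta> > 0 \<Longrightarrow> \<exists>ps q. length ps = n \<and> (\<forall>p\<in>set ps. fst p \<noteq> snd p) \<and>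
    (\<forall>m. selects m ps \<longrightarrow> (\<exists>b. blocks k L n q b \<and> tsirelson_le (f' m - g - b) (real n * \<eta>)))"
    using Suc.IH[of f', OF mem' lip'] by blast
  show ?case
  proof (intro exI[of _ g] allI impI)
    fix \<eta> :: real and k assume "\<eta> > 0"
    then obtain ps q where ps: "length ps = n" "\<forall>p\<in>set ps. fst p \<noteq> snd p"
      and approx: "\<And>m. selects m ps \<Longrightarrow>
        \<exists>b. blocks k L n q b \<and> tsirelson_le (f' m - g - b) (real n * \<eta>)"
      using g by blast
    define d where "d m c = f (m @ [c]) - f' m" for m c
    have "eventually (\<lambda>i. \<forall>m\<in>{m. selects m ps}. (\<Sum>l<q. \<bar>d m (r i) l\<bar>) < \<eta> / 2) sequentially"
    proof (intro eventually_ball_finite finite_selects ballI)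
      fix m
      have "(\<lambda>i. \<Sum>l<q. \<bar>d m (r i) l\<bar>) \<longlonglongrightarrow> (\<Sum>l<q. \<bar>f' m l - f' m l\<bar>)"
        unfolding d_def minus_apply by (intro tendsto_sum tendsto_rabs tendsto_diff f' tendsto_const)
      then show "eventually (\<lambda>i. (\<Sum>l<q. \<bar>d m (r i) l\<bar>) < \<eta> / 2) sequentially"
        using \<open>\<eta> > 0\<close> by (auto dest!: order_tendstoD(2)[of _ _ _ "\<eta> / 2"])
    qed
    then obtain I where I: "\<And>i m. I \<le> i \<Longrightarrow> selects m ps \<Longrightarrow> (\<Sum>l<q. \<bar>d m (r i) l\<bar>) < \<eta> / 2"
      by (auto simp: eventually_sequentially)
    let ?C = "{r I, r (Suc I)}"
    have head: "tsirelson_le (restr 0 q (d m c)) (\<eta> / 2)" if "selects m ps" "c \<in> ?C" for m c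
      using tsirelson.dual_le_mono[OF tsirelson_le_restr_sum[of q "d m c"], of "\<eta> / 2"] that
        I[of I m] I[of "Suc I" m] by auto
    have "\<forall>m c. \<exists>q'. tsirelson_le (tail q' (d m c)) (\<eta> / 2)"
      using tail_small[OF tsirelson.dual_carrierI[OF diff]] \<open>\<eta> > 0\<close> unfolding d_def by simp
    then obtain Q where Q: "\<And>m c. tsirelson_le (tail (Q m c) (d m c)) (\<eta> / 2)" by metis
    define q' where "q' = Max (insert q (case_prod Q ` ({m. selects m ps} \<times> ?C)))"
    have fin: "finite (insert q (case_prod Q ` ({m. selects m ps} \<times> ?C)))"
      using finite_selects by auto
    have q': "q \<le> q'" unfolding q'_def using fin by (intro Max_ge) auto
    have Qq': "Q m c \<le> q'" if "selects m ps" "c \<in> ?C" for m c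
      unfolding q'_def using fin that by (intro Max_ge) force+
    let ?ps = "ps @ [(r I, r (Suc I))]"
    have "\<exists>b. blocks k L (Suc n) q' b \<and> tsirelson_le (f m - g - b) (real (Suc n) * \<eta>)"
      if m0: "selects m ?ps" for m
    proof -
      obtain m' c where m: "m = m' @ [c]" "selects m' ps" "c \<in> ?C"
        using m0 by (auto simp: list_all2_append2 list_all2_Cons2)
      obtain b where b: "blocks k L n q b" "tsirelson_le (f' m' - g - b) (real n * \<eta>)"
        using approx[OF m(2)] by blast
      define u where "u = restr q q' (d m' c)"
      have "tsirelson_le (tail q' (d m' c)) (\<eta> / 2)"
        using tsirelson_le_tail_mono[OF Q Qq'[OF m(2,3)]] .
      then have "tsirelson_le (restr 0 q (d m' c) + tail q' (d m' c)) (\<eta> / 2 + \<eta> / 2)"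
        by (rule tsirelson.dual_le_add[OF head[OF m(2,3)]])
      then have "tsirelson_le ((f' m' - g - b) + (restr 0 q (d m' c) + tail q' (d m' c))) (real n * \<eta> + (\<eta> / 2 + \<eta> / 2))"
        by (rule tsirelson.dual_le_add[OF b(2)])
      moreover have "(f' m' - g - b) + (restr 0 q (d m' c) + tail q' (d m' c)) = f m - g - (b + u)"
        using q' by (auto simp: fun_eq_iff u_def d_def m(1) restr_def tail_def)
      moreover have "real n * \<eta> + (\<eta> / 2 + \<eta> / 2) = real (Suc n) * \<eta>" by (simp add: algebra_simps)
      ultimately have "tsirelson_le (f m - g - (b + u)) (real (Suc n) * \<eta>)" by metis
      moreover have "blocks k L (Suc n) q' (b + u)"
      proof (rule blocks_Suc[OF b(1) q'])
        show "tsirelson_le u L"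
          unfolding u_def d_def by (rule dual_le_restr[OF diff])
      qed (simp add: u_def restr_restr)
      ultimately show ?thesis by blast
    qed
    moreover have "r I \<noteq> r (Suc I)" using r by (metis less_irrefl lessI strict_mono_less)
    ultimately show "\<exists>ps q. length ps = Suc n \<and> (\<forall>p\<in>set ps. fst p \<noteq> snd p) \<and>
      (\<forall>m. selects m ps \<longrightarrow> (\<exists>b. blocks k L (Suc n) q b \<and> tsirelson_le (f m - g - b) (real (Suc n) * \<eta>)))"
      using ps by (intro exI[of _ ?ps] exI[of _ q']) auto
  qed
qed

lemma concentration:
  fixes f :: "nat list \<Rightarrow> nat \<Rightarrow> real"
  assumes mem: "\<And>m. f m \<in> dual_carrier tsirelson_ball"
    and lip: "\<And>m a b m'. tsirelson_le (f (m @ a # m') - f (m @ b # m')) L" and "L > 0"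
  shows "\<exists>ps. length ps = n \<and> (\<forall>p\<in>set ps. fst p \<noteq> snd p) \<and>
    (\<forall>m m'. selects m ps \<longrightarrow> selects m' ps \<longrightarrow> tsirelson_le (f m - f m') (8 * L))"
proof -
  define \<eta> where "\<eta> = L / (real n + 1)"
  have \<eta>: "\<eta> > 0" "real n * \<eta> \<le> L" using \<open>L > 0\<close> by (auto simp: \<eta>_def field_simps)
  obtain g ps q where ps: "length ps = n" "\<forall>p\<in>set ps. fst p \<noteq> snd p"
    and approx: "\<And>m. selects m ps \<Longrightarrow>
      \<exists>b. blocks n L n q b \<and> tsirelson_le (f m - g - b) (real n * \<eta>)"
    using tree_approximation[of f L n, OF mem lip] \<eta>(1) by meson
  have close: "tsirelson_le (f m - g) (4 * L)" if m: "selects m ps" for m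
  proof -
    obtain b where b: "blocks n L n q b" "tsirelson_le (f m - g - b) (real n * \<eta>)"
      using approx[OF m] by blast
    have "tsirelson_le ((f m - g - b) + b) (L + 3 * L)"
      by (intro tsirelson.dual_le_add tsirelson.dual_le_mono[OF b(2) \<eta>(2)] dual_le_blocks[OF b(1)])
        (use \<open>L > 0\<close> in auto)
    then show ?thesis by (simp del: minus_apply plus_fun_apply)
  qed
  have "tsirelson_le (f m - f m') (8 * L)" if "selects m ps" "selects m' ps" for m m'
  proof -
    have "tsirelson_le ((f m - g) - (f m' - g)) (4 * L + 4 * L)"
      by (intro tsirelson.dual_le_diff close that)
    then show ?thesis by (simp del: minus_apply)
  qed
  then show ?thesis using ps by blast
qed

section \<open>Random walks and kernels of negative type\<close>

text \<open>Finitely supported probability laws are represented by nonempty lists, with uniform weights and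
multiplicities.\<close>

definition avg :: "('b \<Rightarrow> real) \<Rightarrow> 'b list \<Rightarrow> real" where
  "avg \<phi> xs = (\<Sum>x\<leftarrow>xs. \<phi> x) / real (length xs)"

lemma avg_add: "avg (\<lambda>x. \<phi> x + \<psi> x) xs = avg \<phi> xs + avg \<psi> xs"
  by (simp add: avg_def sum_list_addf add_divide_distrib)

lemma avg_mult: "avg (\<lambda>x. c * \<phi> x) xs = c * avg \<phi> xs"
  by (simp add: avg_def sum_list_const_mult)

lemma avg_const: "xs \<noteq> [] \<Longrightarrow> avg (\<lambda>x. c) xs = c"
  by (simp add: avg_def sum_list_triv)

lemma avg_mono: "(\<And>x. x \<in> set xs \<Longrightarrow> \<phi> x \<le> \<psi> x) \<Longrightarrow> avg \<phi> xs \<le> avg \<psi> xs"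
  unfolding avg_def by (intro divide_right_mono sum_list_mono) auto

lemma avg_cong: "(\<And>x. x \<in> set xs \<Longrightarrow> \<phi> x = \<psi> x) \<Longrightarrow> avg \<phi> xs = avg \<psi> xs"
  unfolding avg_def by (auto cong: map_cong)

lemma avg_map: "avg \<phi> (map h xs) = avg (\<lambda>x. \<phi> (h x)) xs"
  by (simp add: avg_def comp_def)

lemma avg_sum: "avg (\<lambda>x. \<Sum>i\<in>I. \<phi> i x) xs = (\<Sum>i\<in>I. avg (\<phi> i) xs)"
proof -
  have "(\<Sum>x\<leftarrow>xs. \<Sum>i\<in>I. \<phi> i x) = (\<Sum>i\<in>I. \<Sum>x\<leftarrow>xs. \<phi> i x)"
    by (induction xs) (auto simp: sum.distrib)
  then show ?thesis by (simp add: avg_def sum_divide_distrib)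
qed

lemma avg_avg: "avg (\<lambda>a. avg (\<psi> a) B) A = (\<Sum>a\<leftarrow>A. \<Sum>b\<leftarrow>B. \<psi> a b) / (real (length A) * real (length B))"
proof -
  have "(\<Sum>a\<leftarrow>A. f a / z) = (\<Sum>a\<leftarrow>A. f a) / z" for f :: "'a \<Rightarrow> real" and z
    by (induction A) (auto simp: add_divide_distrib)
  then show ?thesis by (simp add: avg_def mult.commute)
qed

lemma avg_swap: "avg (\<lambda>a. avg (\<psi> a) B) A = avg (\<lambda>b. avg (\<lambda>a. \<psi> a b) A) B"
proof -
  have "(\<Sum>a\<leftarrow>A. \<Sum>b\<leftarrow>B. \<psi> a b) = (\<Sum>b\<leftarrow>B. \<Sum>a\<leftarrow>A. \<psi> a b)"
    by (induction A) (auto simp: sum_list_addf)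
  then show ?thesis by (simp add: avg_avg mult.commute)
qed

text \<open>The law of \<open>a - b\<close> for independent \<open>a\<close> and \<open>b\<close>.\<close>

definition differences :: "'g::ab_group_add list \<Rightarrow> 'g list \<Rightarrow> 'g list" where
  "differences A B = concat (map (\<lambda>a. map (\<lambda>b. a - b) B) A)"

lemma avg_differences: "avg \<phi> (differences A B) = avg (\<lambda>a. avg (\<lambda>b. \<phi> (a - b)) B) A"
proof -
  have "(\<Sum>x\<leftarrow>differences A B. \<phi> x) = (\<Sum>a\<leftarrow>A. \<Sum>b\<leftarrow>B. \<phi> (a - b))"
    by (induction A) (auto simp: differences_def comp_def)
  moreover have "length (differences A B) = length A * length B"
    by (induction A) (auto simp: differences_def)
  ultimately show ?thesis by (simp add: avg_avg) (simp add: avg_def)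
qed

lemma set_differences: "set (differences A B) = {a - b | a b. a \<in> set A \<and> b \<in> set B}"
  by (auto simp: differences_def)

lemma differences_Nil_iff: "differences A B = [] \<longleftrightarrow> A = [] \<or> B = []"
  by (auto simp: differences_def)

text \<open>For a symmetric law, \<open>walk n\<close> is the law of a sum of \<open>2\<^sup>n\<close> independent copies, and
\<open>combine n A\<close> that of a sum of independent vectors with laws \<open>A 0, \<dots>, A (2\<^sup>n - 1)\<close>.\<close>

fun walk :: "nat \<Rightarrow> 'g::ab_group_add list \<Rightarrow> 'g list" where
  "walk 0 A = A"
| "walk (Suc n) A = walk n (differences A A)"

fun combine :: "nat \<Rightarrow> (nat \<Rightarrow> 'g::ab_group_add list) \<Rightarrow> 'g list" where
  "combine 0 A = A 0"
| "combine (Suc n) A = combine n (\<lambda>i. differences (A (2 * i)) (A (2 * i + 1)))"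

lemma walk_Nil_iff: "walk n A = [] \<longleftrightarrow> A = []"
  by (induction n arbitrary: A) (auto simp: differences_Nil_iff)

text \<open>Rearranging \<open>(a - b) - (a' - b') = (a - a') - (b - b')\<close>, with independent copies throughout.\<close>

lemma avg_walk_differences: "avg \<phi> (walk n (differences A B)) = avg \<phi> (differences (walk n A) (walk n B))"
proof (induction n arbitrary: A B \<phi>)
  case (Suc n)
  have "avg \<phi> (walk (Suc n) (differences A B)) =
      avg (\<lambda>a. avg (\<lambda>b. avg (\<lambda>a'. avg (\<lambda>b'. \<phi> ((a - b) - (a' - b'))) (walk n B)) (walk n A)) (walk n B)) (walk n A)"
    by (simp add: Suc avg_differences)
  also have "\<dots> = avg (\<lambda>a. avg (\<lambda>a'. avg (\<lambda>b. avg (\<lambda>b'. \<phi> ((a - b) - (a' - b'))) (walk n B)) (walk n B)) (walk n A)) (walk n A)"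
    by (intro avg_cong avg_swap)
  also have "\<dots> = avg \<phi> (differences (walk (Suc n) A) (walk (Suc n) B))"
    by (simp add: Suc avg_differences algebra_simps)
  finally show ?case .
qed simp

lemma walk_map:
  assumes "\<And>a b. h (a - b) = h a - h b"
  shows "walk n (map h A) = map h (walk n A)"
proof (induction n arbitrary: A)
  case (Suc n)
  have "differences (map h A) (map h A) = map h (differences A A)"
    by (simp add: differences_def map_concat comp_def assms)
  then show ?case using Suc by simp
qed simp

lemma sum_double: "(\<Sum>i<2 * n. h i) = (\<Sum>i<n. h (2 * i) + h (2 * i + 1 :: nat))" for h :: "nat \<Rightarrow> real"
  by (induction n) auto

text \<open>For \<open>N = 1 - \<phi>\<close> with a positive definite function \<open>\<phi>\<close> this is the arithmetic-geometric mean
inequality for the characteristic functions of the \<open>A i\<close>. In general, the assumed inequality for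
\<open>walk n (A (2 i))\<close> and \<open>walk n (A (2 i + 1))\<close> halves the number of laws at each step.\<close>

lemma avg_walk_le_combine:
  fixes N :: "'g::ab_group_add \<Rightarrow> real"
  assumes energy: "\<And>A B. A \<noteq> [] \<Longrightarrow> B \<noteq> [] \<Longrightarrow>
      avg N (differences A A) + avg N (differences B B) \<le> 2 * avg N (differences A B)"
    and "\<And>i. A i \<noteq> []"
  shows "(\<Sum>i<2 ^ n. avg N (walk n (A i))) \<le> 2 ^ n * avg N (combine n A)"
  using assms(2)
proof (induction n arbitrary: A)
  case (Suc n)
  let ?A = "\<lambda>i. differences (A (2 * i)) (A (2 * i + 1))"
  have "(\<Sum>i<2 ^ Suc n. avg N (walk (Suc n) (A i))) =
      (\<Sum>i<2 ^ n. avg N (walk (Suc n) (A (2 * i))) + avg N (walk (Suc n) (A (2 * i + 1))))"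
    by (simp only: power_Suc sum_double)
  also have "\<dots> \<le> (\<Sum>i<2 ^ n. 2 * avg N (walk n (?A i)))"
    using energy Suc.prems by (intro sum_mono) (simp add: avg_walk_differences walk_Nil_iff)
  also have "\<dots> = 2 * (\<Sum>i<2 ^ n. avg N (walk n (?A i)))"
    by (simp add: sum_distrib_left)
  also have "\<dots> \<le> 2 * (2 ^ n * avg N (combine n ?A))"
    using Suc.IH[of ?A] Suc.prems by (simp add: differences_Nil_iff)
  finally show ?case by simp
qed simp

lemma combine_coordinates:
  fixes A :: "nat \<Rightarrow> (nat \<Rightarrow> int) list"
  assumes "\<And>i a j. a \<in> set (A i) \<Longrightarrow> \<bar>a j\<bar> = (if i * w \<le> j \<and> j < Suc i * w then 1 else 0)"
    and "v \<in> set (combine n A)" "j < w * 2 ^ n"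
  shows "\<bar>v j\<bar> = 1"
  using assms
proof (induction n arbitrary: A w)
  case (Suc n)
  have "\<bar>a j\<bar> = (if i * (2 * w) \<le> j \<and> j < Suc i * (2 * w) then 1 else 0)"
    if a: "a \<in> set (differences (A (2 * i)) (A (2 * i + 1)))" for i a j
  proof -
    obtain b c where a: "a = b - c" "b \<in> set (A (2 * i))" "c \<in> set (A (2 * i + 1))"
      using a by (auto simp: set_differences)
    show ?thesis using Suc.prems(1)[OF a(2), of j] Suc.prems(1)[OF a(3), of j]
      by (auto simp: a(1) algebra_simps split: if_splits)
  qed
  then show ?case
    using Suc.prems Suc.IH[of "\<lambda>i. differences (A (2 * i)) (A (2 * i + 1))" "2 * w"]
    by (simp add: algebra_simps)
qed auto

abbreviation simple_walk :: "nat \<Rightarrow> int list" where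
  "simple_walk n \<equiv> walk n [1, - 1]"

text \<open>The walk of \<open>2\<^sup>n\<^sup>+\<^sup>1\<close> steps is the difference of two independent walks of \<open>2\<^sup>n\<close> steps.\<close>

lemma simple_walk_moments:
  "avg (\<lambda>w. real_of_int w) (simple_walk n) = 0 \<and>
   avg (\<lambda>w. real_of_int w ^ 2) (simple_walk n) = 2 ^ n \<and>
   avg (\<lambda>w. real_of_int w ^ 4) (simple_walk n) \<le> 3 * 4 ^ n"
proof (induction n)
  case 0
  show ?case by (simp add: avg_def)
next
  case (Suc n)
  let ?W = "simple_walk n"
  let ?m = "\<lambda>k. avg (\<lambda>w. real_of_int w ^ k) ?W"
  have ne: "?W \<noteq> []" by (simp add: walk_Nil_iff)
  have E: "avg \<phi> (simple_walk (Suc n)) = avg (\<lambda>a. avg (\<lambda>b. \<phi> (a - b)) ?W) ?W" for \<phi>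
    by (simp only: walk.simps avg_walk_differences avg_differences)
  have m1: "?m 1 = 0" using Suc by simp
  have "avg (\<lambda>w. real_of_int w) (simple_walk (Suc n)) = 0"
  proof -
    have "real_of_int (a - b) = real_of_int a ^ 1 + (- 1) * real_of_int b ^ 1" for a b by simp
    then show ?thesis
      unfolding E by (simp only: avg_add avg_mult m1 avg_const[OF ne])
  qed
  moreover have "avg (\<lambda>w. real_of_int w ^ 2) (simple_walk (Suc n)) = 2 * ?m 2"
  proof -
    have "real_of_int (a - b) ^ 2 = real_of_int a ^ 2 + ((- 2 * real_of_int a) * real_of_int b ^ 1 + real_of_int b ^ 2)" for a b
      by (simp add: power2_eq_square algebra_simps)
    then show ?thesis
      unfolding E by (simp only: avg_add avg_mult m1 avg_const[OF ne] mult_zero_right add_0 mult_2)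
  qed
  moreover have "avg (\<lambda>w. real_of_int w ^ 4) (simple_walk (Suc n)) = 2 * ?m 4 + 6 * (?m 2)\<^sup>2"
  proof -
    have "real_of_int (a - b) ^ 4 = real_of_int a ^ 4 + ((- 4 * real_of_int a ^ 3) * real_of_int b ^ 1 +
        ((6 * real_of_int a ^ 2) * real_of_int b ^ 2 + ((- 4 * real_of_int a) * real_of_int b ^ 3 + real_of_int b ^ 4)))" for a b
      by (simp add: power4_eq_xxxx power3_eq_cube power2_eq_square algebra_simps)
    moreover have "avg (\<lambda>a. real_of_int a ^ 4 + (- 4 * real_of_int a ^ 3 * 0 +
        (6 * real_of_int a ^ 2 * ?m 2 + (- 4 * real_of_int a * ?m 3 + ?m 4)))) ?W =
        avg (\<lambda>a. real_of_int a ^ 4 + ((6 * ?m 2) * real_of_int a ^ 2 + ((- 4 * ?m 3) * real_of_int a ^ 1 + ?m 4))) ?W"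
      by (intro avg_cong) (simp add: algebra_simps)
    ultimately show ?thesis
      unfolding E by (simp only: avg_add avg_mult m1 avg_const[OF ne]) (simp add: power2_eq_square)
  qed
  moreover have "(2 ^ n)\<^sup>2 = (4::real) ^ n" by (simp add: power2_eq_square flip: power_mult_distrib)
  ultimately show ?case using Suc by (simp del: walk.simps)
qed

lemma simple_walk_bound: "w \<in> set (simple_walk n) \<Longrightarrow> \<bar>w\<bar> \<le> 2 ^ n"
proof -
  have "\<bar>w\<bar> \<le> c * 2 ^ n" if "\<forall>a\<in>set A. \<bar>a\<bar> \<le> c" "w \<in> set (walk n A)" for A and c :: int
    using that
  proof (induction n arbitrary: A c)
    case (Suc n)
    have "\<forall>a\<in>set (differences A A). \<bar>a\<bar> \<le> 2 * c"
    proof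
      fix a assume "a \<in> set (differences A A)"
      then obtain b b' where "a = b - b'" "b \<in> set A" "b' \<in> set A" by (auto simp: set_differences)
      moreover have "\<bar>b - b'\<bar> \<le> \<bar>b\<bar> + \<bar>b'\<bar>" by (rule abs_triangle_ineq4)
      moreover have "\<bar>b\<bar> \<le> c" "\<bar>b'\<bar> \<le> c" using calculation Suc.prems(1) by auto
      ultimately show "\<bar>a\<bar> \<le> 2 * c" by linarith
    qed
    from Suc.IH[OF this] Suc.prems(2) show ?case by simp
  qed auto
  from this[of "[1, -1]" 1] show "w \<in> set (simple_walk n) \<Longrightarrow> \<bar>w\<bar> \<le> 2 ^ n" by simp
qed

text \<open>Second moment method: the end point \<open>w\<close> of the walk satisfies \<open>2 w\<^sup>2 \<ge> 2\<^sup>n\<close> with probability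
at least \<open>1/12\<close>, because its second moment is \<open>2\<^sup>n\<close> and its fourth moment is of the order of
the square of that.\<close>

lemma simple_walk_spread:
  assumes "\<And>w. \<psi> w \<ge> 0" "c \<ge> 0"
    and "\<And>w. 2 ^ n \<le> 2 * w\<^sup>2 \<Longrightarrow> \<bar>w\<bar> \<le> 2 ^ n \<Longrightarrow> c \<le> \<psi> w"
  shows "c \<le> 12 * avg \<psi> (simple_walk n)"
proof -
  let ?W = "simple_walk n"
  define T :: real where "T = 2 ^ n"
  have T: "T > 0" by (simp add: T_def)
  have ne: "?W \<noteq> []" by (simp add: walk_Nil_iff)
  have m: "avg (\<lambda>w. real_of_int w ^ 2) ?W = T" "avg (\<lambda>w. real_of_int w ^ 4) ?W \<le> 3 * T\<^sup>2"
    using simple_walk_moments[of n] by (auto simp: T_def power2_eq_square simp flip: power_mult_distrib)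
  have "c * real_of_int w ^ 2 \<le> c * T / 2 + (c / (12 * T) * real_of_int w ^ 4 + 3 * T * \<psi> w)" if "w \<in> set ?W" for w
  proof (cases "2 ^ n \<le> 2 * w\<^sup>2")
    case True
    then have "c \<le> \<psi> w" using assms(3) simple_walk_bound[OF that] by blast
    then have "T * c \<le> T * \<psi> w" using T by simp
    \<comment> \<open>With the constant 6, the bound \<open>3 T\<^sup>2\<close> on the fourth moment costs just \<open>c T / 4\<close>.\<close>
    have "0 \<le> (real_of_int w ^ 2 - 6 * T) ^ 2" by simp
    then have "real_of_int w ^ 2 \<le> real_of_int w ^ 4 / (12 * T) + 3 * T"
      using T by (simp add: field_simps power2_eq_square power4_eq_xxxx)
    then have "c * real_of_int w ^ 2 \<le> c * (real_of_int w ^ 4 / (12 * T) + 3 * T)"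
      using assms(2) by (rule mult_left_mono)
    also have "\<dots> \<le> c / (12 * T) * real_of_int w ^ 4 + 3 * T * \<psi> w"
      using \<open>T * c \<le> T * \<psi> w\<close> by (simp add: algebra_simps)
    finally show ?thesis using assms(2) T by (simp add: add_increasing)
  next
    case False
    then have "real_of_int (2 * w\<^sup>2) \<le> real_of_int (2 ^ n)" by (simp only: of_int_le_iff)
    then have "real_of_int w ^ 2 \<le> T / 2" by (simp add: T_def)
    then have "c * real_of_int w ^ 2 \<le> c * T / 2" using assms(2) mult_left_mono by fastforce
    moreover have "0 \<le> c / (12 * T) * real_of_int w ^ 4" "0 \<le> 3 * T * \<psi> w"
      using assms(1,2) T by auto
    ultimately show ?thesis by linarith
  qed
  then have "avg (\<lambda>w. c * real_of_int w ^ 2) ?W \<le>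
      avg (\<lambda>w. c * T / 2 + (c / (12 * T) * real_of_int w ^ 4 + 3 * T * \<psi> w)) ?W"
    by (rule avg_mono)
  then have "c * T \<le> c * T / 2 + (c / (12 * T) * avg (\<lambda>w. real_of_int w ^ 4) ?W + 3 * T * avg \<psi> ?W)"
    by (simp only: avg_add avg_mult avg_const[OF ne] m)
  also have "\<dots> \<le> c * T / 2 + (c / (12 * T) * (3 * T\<^sup>2) + 3 * T * avg \<psi> ?W)"
    using m(2) assms(2) T by (intro add_left_mono add_right_mono mult_left_mono) auto
  also have "\<dots> = T * (c * 3 / 4 + 3 * avg \<psi> ?W)" using T by (simp add: field_simps power2_eq_square)
  finally have "T * c \<le> T * (c * 3 / 4 + 3 * avg \<psi> ?W)" by (simp add: mult.commute)
  then show ?thesis using T by simp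
qed

text \<open>Functions on \<open>(\<int>/M\<int>)\<^sup>k\<close> are represented by functions on integer sequences that are invariant under
\<open>reduce k M\<close>; then the ambient group acts by translation.\<close>

definition reduce :: "nat \<Rightarrow> int \<Rightarrow> (nat \<Rightarrow> int) \<Rightarrow> nat \<Rightarrow> int" where
  "reduce k M x = restrict (\<lambda>j. x j mod M) {..<k}"

abbreviation torus :: "nat \<Rightarrow> int \<Rightarrow> (nat \<Rightarrow> int) set" where
  "torus k M \<equiv> PiE {..<k} (\<lambda>_. {0..<M})"

lemma reduce_add: "reduce k M (reduce k M x + v) = reduce k M (x + v)"
  by (auto simp: reduce_def restrict_def fun_eq_iff mod_add_left_eq)

lemma reduce_mem: "M > 0 \<Longrightarrow> reduce k M x \<in> torus k M"
  by (auto simp: reduce_def)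

lemma reduce_torus: "x \<in> torus k M \<Longrightarrow> reduce k M x = x"
  by (auto simp: reduce_def restrict_def fun_eq_iff PiE_iff extensional_def)

lemma sum_torus_shift:
  fixes \<phi> :: "(nat \<Rightarrow> int) \<Rightarrow> real"
  assumes "M > 0" and per: "\<And>x. \<phi> (reduce k M x) = \<phi> x"
  shows "(\<Sum>x\<in>torus k M. \<phi> (x + v)) = (\<Sum>x\<in>torus k M. \<phi> x)"
proof (rule sum.reindex_bij_witness[where i = "\<lambda>x. reduce k M (x - v)" and j = "\<lambda>x. reduce k M (x + v)"])
  fix x assume x: "x \<in> torus k M"
  show "reduce k M (reduce k M (x + v) - v) = x"
    using reduce_add[of k M "x + v" "- v"] reduce_torus[OF x] by (simp del: minus_apply plus_fun_apply)
  show "reduce k M (reduce k M (x - v) + v) = x"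
    using reduce_add[of k M "x - v" "v"] reduce_torus[OF x] by (simp del: minus_apply plus_fun_apply)
  show "reduce k M (x + v) \<in> torus k M" "reduce k M (x - v) \<in> torus k M"
    using reduce_mem[OF \<open>M > 0\<close>] by blast+
  show "\<phi> (reduce k M (x + v)) = \<phi> (x + v)" by (rule per)
qed

text \<open>For squared Hilbert distances, the difference of the two sides is twice the squared distance of
the barycentres of the two laws.\<close>

definition negative_type :: "('p \<Rightarrow> 'p \<Rightarrow> real) \<Rightarrow> bool" where
  "negative_type D \<longleftrightarrow> (\<forall>A B. A \<noteq> [] \<longrightarrow> B \<noteq> [] \<longrightarrow>
     avg (\<lambda>a. avg (D a) A) A + avg (\<lambda>a. avg (D a) B) B \<le> 2 * avg (\<lambda>a. avg (D a) B) A)"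

definition axis_point :: "nat \<Rightarrow> int \<Rightarrow> nat \<Rightarrow> int" where
  "axis_point i w j = (if j = i then w else 0)"

text \<open>Summing over the torus makes the kernel translation invariant: the distance of \<open>p z\<close> and
\<open>p (z + (a - b))\<close> and that of \<open>p (z + b)\<close> and \<open>p (z + a)\<close> have the same sum over \<open>z\<close>.\<close>

lemma torus_energy:
  fixes p :: "(nat \<Rightarrow> int) \<Rightarrow> 'p"
  assumes D: "negative_type D" and "M > 0" and per: "\<And>x. p (reduce k M x) = p x"
    and "A \<noteq> []" "B \<noteq> []"
  defines "N \<equiv> \<lambda>v. \<Sum>x\<in>torus k M. D (p x) (p (x + v))"
  shows "avg N (differences A A) + avg N (differences B B) \<le> 2 * avg N (differences A B)"
proof -
  have N: "N (a - b) = (\<Sum>x\<in>torus k M. D (p (x + b)) (p (x + a)))" for a b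
  proof -
    have "N (a - b) = (\<Sum>x\<in>torus k M. D (p (x + b)) (p (x + b + (a - b))))"
      unfolding N_def
    proof (rule sum_torus_shift[OF \<open>M > 0\<close>, symmetric])
      have "p (reduce k M x + (a - b)) = p (x + (a - b))" for x
        by (metis per reduce_add)
      then show "D (p (reduce k M x)) (p (reduce k M x + (a - b))) = D (p x) (p (x + (a - b)))" for x
        using per by simp
    qed
    then show ?thesis by (simp add: algebra_simps del: minus_apply plus_fun_apply)
  qed
  have *: "avg N (differences A B) = (\<Sum>x\<in>torus k M. avg (\<lambda>u. avg (D u) (map (\<lambda>a. p (x + a)) A)) (map (\<lambda>b. p (x + b)) B))"
    for A B
    unfolding avg_differences N avg_sum avg_map by (intro sum.cong refl avg_swap)
  have "(\<Sum>x\<in>torus k M. avg (\<lambda>u. avg (D u) (map (\<lambda>a. p (x + a)) A)) (map (\<lambda>a. p (x + a)) A)) +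
      (\<Sum>x\<in>torus k M. avg (\<lambda>u. avg (D u) (map (\<lambda>a. p (x + a)) B)) (map (\<lambda>a. p (x + a)) B)) \<le>
      (\<Sum>x\<in>torus k M. 2 * avg (\<lambda>u. avg (D u) (map (\<lambda>a. p (x + a)) A)) (map (\<lambda>a. p (x + a)) B))"
    unfolding sum.distrib[symmetric]
  proof (rule sum_mono)
    fix x
    show "avg (\<lambda>u. avg (D u) (map (\<lambda>a. p (x + a)) A)) (map (\<lambda>a. p (x + a)) A) +
      avg (\<lambda>u. avg (D u) (map (\<lambda>a. p (x + a)) B)) (map (\<lambda>a. p (x + a)) B) \<le>
      2 * avg (\<lambda>u. avg (D u) (map (\<lambda>a. p (x + a)) A)) (map (\<lambda>a. p (x + a)) B)"
      using D[unfolded negative_type_def, rule_format, of "map (\<lambda>a. p (x + a)) B" "map (\<lambda>a. p (x + a)) A"] assms(4,5)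
      by (simp add: add.commute del: plus_fun_apply)
  qed
  then show ?thesis unfolding * by (simp add: sum_distrib_left)
qed

lemma shift_into_first_quarter:
  fixes x T :: int
  assumes "T > 0"
  shows "\<exists>s<4::nat. (x + int s * T) mod (4 * T) < T"
proof -
  define q where "q = (x mod (4 * T)) div T"
  have x: "0 \<le> x mod (4 * T)" "x mod (4 * T) < 4 * T" using assms by auto
  have "x mod (4 * T) = q * T + x mod (4 * T) mod T" by (simp add: q_def)
  then obtain r where r: "x mod (4 * T) = q * T + r" "0 \<le> r" "r < T" using assms by (meson pos_mod_bound pos_mod_sign)
  then have "q * T < 4 * T" using x(2) by linarith
  then have q: "0 \<le> q" "q < 4"
    using assms x(1) by (auto simp: q_def pos_imp_zdiv_nonneg_iff)
  define s where "s = nat ((4 - q) mod 4)"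
  have "q = 0 \<or> q = 1 \<or> q = 2 \<or> q = 3" using q by auto
  then have s: "q + int s = 0 \<or> q + int s = 4" "s < 4" by (auto simp: s_def)
  have "(x + int s * T) mod (4 * T) = (x mod (4 * T) + int s * T) mod (4 * T)"
    by (simp add: mod_add_left_eq)
  also have "x mod (4 * T) + int s * T = r + (q + int s) * T" unfolding r(1) by (simp add: algebra_simps)
  also have "\<dots> mod (4 * T) = r mod (4 * T)" using s(1) by auto
  also have "\<dots> = r" using r assms by simp
  finally show ?thesis using s(2) r(3) by auto
qed

text \<open>If moving all coordinates by one step costs at most \<open>W\<close>, then moving one coordinate by about
\<open>T\<^sup>1\<^sup>/\<^sup>2\<close> steps cannot always cost more than \<open>48 W\<close>. The factor 12 is the inverse of the probability in
\<open>simple_walk_spread\<close>. The factor 4 arises because \<open>lower\<close> constrains only a quarter of the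
torus, where a periodic image of the line of period \<open>4 T\<close> does not turn back within \<open>T\<close> steps.\<close>

theorem cube_obstruction:
  fixes p :: "(nat \<Rightarrow> int) \<Rightarrow> 'p" and n :: nat
  defines "T \<equiv> 2 ^ n :: int"
  assumes D: "negative_type D" and nonneg: "\<And>u v. D u v \<ge> 0"
    and per: "\<And>x. p (reduce (2 ^ n) (4 * T) x) = p x"
    and upper: "\<And>x v. (\<And>j. j < 2 ^ n \<Longrightarrow> \<bar>v j\<bar> = 1) \<Longrightarrow> D (p x) (p (x + v)) \<le> W"
    and lower: "\<And>i x w. i < 2 ^ n \<Longrightarrow> T \<le> 2 * w\<^sup>2 \<Longrightarrow> \<bar>w\<bar> \<le> T \<Longrightarrow>
      (if 0 \<le> w then x i mod (4 * T) < T else T \<le> x i mod (4 * T) \<and> x i mod (4 * T) < 2 * T) \<Longrightarrow>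
      c \<le> D (p x) (p (x + axis_point i w))"
    and "c \<ge> 0"
  shows "c \<le> 48 * W"
proof -
  let ?P = "torus (2 ^ n) (4 * T)"
  have T: "T > 0" by (simp add: T_def)
  have "finite ?P" by (intro finite_PiE) auto
  moreover have "reduce (2 ^ n) (4 * T) 0 \<in> ?P" using T by (intro reduce_mem) auto
  ultimately have card: "card ?P > 0" by (auto simp: card_gt_0_iff)
  define N where "N v = (\<Sum>x\<in>?P. D (p x) (p (x + v)))" for v
  define A where "A i = map (axis_point i) [1, - 1]" for i
  have energy: "avg N (differences A A) + avg N (differences B B) \<le> 2 * avg N (differences A B)"
    if "A \<noteq> []" "B \<noteq> []" for A B
    unfolding N_def using T that by (intro torus_energy[OF D] per) auto
  have walk_le: "(\<Sum>i<2 ^ n. avg N (walk n (A i))) \<le> 2 ^ n * avg N (combine n A)"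
    by (rule avg_walk_le_combine[OF energy]) (auto simp: A_def)
  have "avg N (combine n A) \<le> avg (\<lambda>_. card ?P * W) (combine n A)"
  proof (rule avg_mono)
    fix v assume v: "v \<in> set (combine n A)"
    have "\<bar>v j\<bar> = 1" if "j < 2 ^ n" for j
      by (rule combine_coordinates[of A 1, OF _ v]) (use that in \<open>auto simp: A_def axis_point_def\<close>)
    then have "N v \<le> (\<Sum>x\<in>?P. W)" unfolding N_def by (intro sum_mono upper)
    then show "N v \<le> card ?P * W" by simp
  qed
  moreover have "combine n A \<noteq> []"
  proof -
    have "combine n A \<noteq> []" if "\<And>i. A i \<noteq> []" for A :: "nat \<Rightarrow> (nat \<Rightarrow> int) list"
      using that by (induction n arbitrary: A) (auto simp: differences_Nil_iff)
    then show ?thesis by (simp add: A_def)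
  qed
  ultimately have combine_le: "avg N (combine n A) \<le> card ?P * W" by (simp add: avg_const)
  have axis_ge: "card ?P * c / 4 \<le> N (axis_point i w)"
    if i: "i < 2 ^ n" and w: "2 ^ n \<le> 2 * w\<^sup>2" "\<bar>w\<bar> \<le> 2 ^ n" for i w
  proof -
    define \<phi> where "\<phi> x = D (p x) (p (x + axis_point i w))" for x
    have per': "\<phi> (reduce (2 ^ n) (4 * T) x) = \<phi> x" for x
      unfolding \<phi>_def by (metis per reduce_add)
    \<comment> \<open>Among the translates of \<open>x\<close> by multiples of \<open>T\<close> along axis \<open>i\<close>, one satisfies the premise of \<open>lower\<close>.\<close>
    have "c \<le> (\<Sum>s<4. \<phi> (x + axis_point i (int s * T)))" for x
    proof -
      obtain s :: nat where s: "s < 4" "if 0 \<le> w then (x i + int s * T) mod (4 * T) < T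
          else T \<le> (x i + int s * T) mod (4 * T) \<and> (x i + int s * T) mod (4 * T) < 2 * T"
      proof (cases "0 \<le> w")
        case True
        then show thesis using shift_into_first_quarter[OF T, of "x i"] that by auto
      next
        case False
        obtain s :: nat where s: "s < 4" "(x i - T + int s * T) mod (4 * T) < T"
          using shift_into_first_quarter[OF T] by blast
        define r where "r = (x i - T + int s * T) mod (4 * T)"
        have r: "0 \<le> r" "r < T" using s(2) T by (auto simp: r_def)
        have "(x i + int s * T) mod (4 * T) = (r + T) mod (4 * T)"
          unfolding r_def mod_add_left_eq by (simp add: algebra_simps)
        also have "\<dots> = r + T" using r by simp
        finally show thesis using that[OF s(1)] r False by simp
      qed
      have "c \<le> \<phi> (x + axis_point i (int s * T))"
        unfolding \<phi>_def using i w s(2) by (intro lower) (auto simp: T_def axis_point_def)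
      also have "\<dots> \<le> (\<Sum>s<4. \<phi> (x + axis_point i (int s * T)))"
        using s(1) nonneg by (intro member_le_sum) (auto simp: \<phi>_def)
      finally show ?thesis .
    qed
    then have "(\<Sum>x\<in>?P. c) \<le> (\<Sum>x\<in>?P. \<Sum>s<4. \<phi> (x + axis_point i (int s * T)))"
      by (intro sum_mono)
    also have "\<dots> = (\<Sum>s<4::nat. \<Sum>x\<in>?P. \<phi> (x + axis_point i (int s * T)))"
      by (rule sum.swap)
    also have "\<dots> = (\<Sum>s<4::nat. N (axis_point i w))"
    proof (rule sum.cong[OF refl])
      fix s :: nat
      have "(\<Sum>x\<in>?P. \<phi> (x + axis_point i (int s * T))) = (\<Sum>x\<in>?P. \<phi> x)"
        using T by (intro sum_torus_shift per') auto
      then show "(\<Sum>x\<in>?P. \<phi> (x + axis_point i (int s * T))) = N (axis_point i w)"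
        by (simp add: N_def \<phi>_def)
    qed
    finally show ?thesis by simp
  qed
  have "card ?P * c / 4 \<le> 12 * avg N (walk n (A i))" if "i < 2 ^ n" for i
  proof -
    have "walk n (A i) = map (axis_point i) (simple_walk n)"
      unfolding A_def by (rule walk_map) (auto simp: axis_point_def fun_eq_iff)
    moreover have "card ?P * c / 4 \<le> 12 * avg (\<lambda>w. N (axis_point i w)) (simple_walk n)"
      using \<open>c \<ge> 0\<close> nonneg axis_ge[OF that] by (intro simple_walk_spread) (auto simp: N_def intro: sum_nonneg)
    ultimately show ?thesis by (simp add: avg_map)
  qed
  then have "(\<Sum>i<2 ^ n::nat. card ?P * c / 4) \<le> (\<Sum>i<2 ^ n. 12 * avg N (walk n (A i)))"
    by (intro sum_mono) auto
  also have "\<dots> \<le> 12 * (2 ^ n * (card ?P * W))"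
    using walk_le combine_le by (simp add: sum_distrib_left[symmetric] order_trans[OF walk_le])
  finally have "(2 ^ n * real (card ?P)) * c \<le> (2 ^ n * real (card ?P)) * (48 * W)"
    by (simp add: algebra_simps)
  then show ?thesis using card by simp
qed

section \<open>Hilbert space\<close>

definition l2_ball :: "(nat \<Rightarrow> real) set" where
  "l2_ball = {x. finite {n. x n \<noteq> 0} \<and> (\<Sum>n | x n \<noteq> 0. (x n)\<^sup>2) \<le> 1}"

interpretation l2: test_set l2_ball
proof
  show "unit_seq n \<in> l2_ball" for n
  proof -
    have "{m. unit_seq n m \<noteq> 0} = {n}" by (auto simp: unit_seq_def)
    then show ?thesis by (simp add: l2_ball_def unit_seq_def)
  qed
qed (auto simp: l2_ball_def)

lemma l2_ball_coord:
  assumes "x \<in> l2_ball"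
  shows "\<bar>x n\<bar> \<le> 1"
proof (cases "x n = 0")
  case False
  then have "(x n)\<^sup>2 \<le> (\<Sum>n | x n \<noteq> 0. (x n)\<^sup>2)"
    using assms by (intro member_le_sum) (auto simp: l2_ball_def)
  also have "\<dots> \<le> 1" using assms by (simp add: l2_ball_def)
  finally show ?thesis by (simp add: abs_square_le_1)
qed simp

lemma l2_le_partial_sum:
  assumes "dual_le l2_ball y c"
  shows "(\<Sum>n<N. (y n)\<^sup>2) \<le> c\<^sup>2"
proof -
  define r where "r = sqrt (\<Sum>n<N. (y n)\<^sup>2)"
  have r2: "r\<^sup>2 = (\<Sum>n<N. (y n)\<^sup>2)" by (simp add: r_def sum_nonneg)
  have "r \<ge> 0" by (simp add: r_def sum_nonneg)
  have c: "c \<ge> 0" using l2.dual_le_nonneg[OF assms] .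
  show ?thesis
  proof (cases "r = 0")
    case True
    then show ?thesis using c r2 by simp
  next
    case False
    define x where "x n = (if n < N then y n / r else 0)" for n
    have sub: "{n. x n \<noteq> 0} \<subseteq> {..<N}" by (auto simp: x_def)
    have "(\<Sum>n | x n \<noteq> 0. (x n)\<^sup>2) = (\<Sum>n<N. (x n)\<^sup>2)"
      using sub by (intro sum.mono_neutral_left) auto
    also have "\<dots> = (\<Sum>n<N. (y n)\<^sup>2) / r\<^sup>2"
      by (simp add: x_def power_divide sum_divide_distrib)
    also have "\<dots> = 1" using False by (simp flip: r2)
    finally have "x \<in> l2_ball" using finite_subset[OF sub] by (simp add: l2_ball_def)
    then have "pairing y x \<le> c" using assms by (simp add: dual_le_def)
    moreover have "pairing y x = (\<Sum>n<N. y n * x n)" using sub by (intro pairing_eq_sum) auto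
    moreover have "(\<Sum>n<N. y n * x n) = (\<Sum>n<N. (y n)\<^sup>2) / r"
      by (simp add: x_def power2_eq_square sum_divide_distrib)
    moreover have "\<dots> = r" unfolding r2[symmetric] using False by (simp add: power2_eq_square)
    ultimately have "r \<le> c" by simp
    then show ?thesis unfolding r2[symmetric] using \<open>r \<ge> 0\<close> by (intro power_mono)
  qed
qed

lemma l2_leI:
  assumes "\<And>N. (\<Sum>n<N. (y n)\<^sup>2) \<le> c\<^sup>2" "c \<ge> 0"
  shows "dual_le l2_ball y c"
  unfolding dual_le_def
proof
  fix x assume x: "x \<in> l2_ball"
  then obtain N where N: "{n. x n \<noteq> 0} \<subseteq> {..<N}"
    using finite_nat_set_iff_bounded[of "{n. x n \<noteq> 0}"] by (auto simp: l2_ball_def)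
  have "(\<Sum>n<N. (x n)\<^sup>2) = (\<Sum>n | x n \<noteq> 0. (x n)\<^sup>2)"
    using N by (intro sum.mono_neutral_right) auto
  also have "\<dots> \<le> 1" using x by (simp add: l2_ball_def)
  finally have x1: "(\<Sum>n<N. (x n)\<^sup>2) \<le> 1" .
  have "(\<Sum>n<N. y n * x n)\<^sup>2 \<le> (\<Sum>n<N. (y n)\<^sup>2) * (\<Sum>n<N. (x n)\<^sup>2)"
    by (rule Cauchy_Schwarz_ineq_sum)
  also have "\<dots> \<le> c\<^sup>2 * 1" using assms x1 by (intro mult_mono) (auto intro: sum_nonneg)
  finally have "(\<Sum>n<N. y n * x n) \<le> c"
    using power2_le_imp_le[OF _ assms(2)] by simp
  moreover have "pairing y x = (\<Sum>n<N. y n * x n)" using N by (intro pairing_eq_sum) auto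
  ultimately show "pairing y x \<le> c" by simp
qed

text \<open>Partial sums of squares link the dual norm to coordinates, so inequalities between squared
distances can be checked coordinate by coordinate.\<close>

lemma l2_norm_sums:
  assumes y: "y \<in> dual_carrier l2_ball"
  shows "(\<lambda>N. \<Sum>n<N. (y n)\<^sup>2) \<longlonglongrightarrow> (dual_norm l2_ball y)\<^sup>2"
proof -
  let ?s = "\<lambda>N. \<Sum>n<N. (y n)\<^sup>2"
  have mono: "incseq ?s" by (intro incseq_SucI) simp
  have bound: "?s N \<le> (dual_norm l2_ball y)\<^sup>2" for N
    by (rule l2_le_partial_sum[OF l2.dual_le_norm[OF y]])
  obtain L where L: "?s \<longlonglongrightarrow> L" "\<And>N. ?s N \<le> L"
    using incseq_convergent[OF mono] bound by blast
  have "L \<ge> 0" using L(2)[of 0] by simp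
  then have "dual_le l2_ball y (sqrt L)" using L(2) by (intro l2_leI) auto
  then have "dual_norm l2_ball y \<le> sqrt L" using l2.dual_norm_le_iff[OF y] by blast
  then have "(dual_norm l2_ball y)\<^sup>2 \<le> L"
    using \<open>L \<ge> 0\<close> l2.dual_norm_nonneg[OF y] by (metis power_mono real_sqrt_pow2)
  moreover have "L \<le> (dual_norm l2_ball y)\<^sup>2" using bound by (intro LIMSEQ_le_const2[OF L(1)]) auto
  ultimately show ?thesis using L(1) by simp
qed

lemma tendsto_avg:
  "(\<And>x. (\<lambda>N. \<phi> N x) \<longlonglongrightarrow> \<psi> x) \<Longrightarrow> (\<lambda>N. avg (\<phi> N) xs) \<longlonglongrightarrow> avg \<psi> xs"
proof -
  assume "\<And>x. (\<lambda>N. \<phi> N x) \<longlonglongrightarrow> \<psi> x"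
  then have "(\<lambda>N. \<Sum>x\<leftarrow>xs. \<phi> N x) \<longlonglongrightarrow> (\<Sum>x\<leftarrow>xs. \<psi> x)"
    by (induction xs) (auto intro: tendsto_add)
  then show ?thesis unfolding avg_def divide_inverse by (intro tendsto_mult tendsto_const)
qed

lemma square_energy:
  assumes "A \<noteq> []" "B \<noteq> []"
  shows "avg (\<lambda>a. avg (\<lambda>b. (f a - f b)\<^sup>2) A) A + avg (\<lambda>a. avg (\<lambda>b. (f a - f b)\<^sup>2) B) B
    \<le> 2 * avg (\<lambda>a. avg (\<lambda>b. (f a - f b)\<^sup>2) B) A"
proof -
  have *: "avg (\<lambda>a. avg (\<lambda>b. (f a - f b)\<^sup>2) B) A =
      avg (\<lambda>a. f a ^ 2) A - 2 * avg f A * avg f B + avg (\<lambda>a. f a ^ 2) B"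
    if "A \<noteq> []" "B \<noteq> []" for A B
  proof -
    have "(f a - f b)\<^sup>2 = (f a)\<^sup>2 + ((- 2 * f a) * f b + (f b)\<^sup>2)" for a b
      by (simp add: power2_eq_square algebra_simps)
    then have "avg (\<lambda>a. avg (\<lambda>b. (f a - f b)\<^sup>2) B) A =
        avg (\<lambda>a. (f a)\<^sup>2 + ((- 2 * f a) * avg f B + avg (\<lambda>b. (f b)\<^sup>2) B)) A"
      by (simp only: avg_add avg_mult avg_const[OF that(2)])
    also have "\<dots> = avg (\<lambda>a. (f a)\<^sup>2 + ((- 2 * avg f B) * f a + avg (\<lambda>b. (f b)\<^sup>2) B)) A"
      by (intro avg_cong) (simp add: algebra_simps)
    finally show ?thesis
      by (simp only: avg_add avg_mult avg_const[OF that(1)]) (simp add: algebra_simps)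
  qed
  have "0 \<le> avg f A * avg f A - 2 * avg f A * avg f B + avg f B * avg f B"
    using zero_le_power2[of "avg f A - avg f B"] by (simp add: power2_eq_square algebra_simps)
  then show ?thesis
    unfolding *[OF assms(1) assms(1)] *[OF assms(2) assms(2)] *[OF assms] by (simp add: algebra_simps)
qed

lemma negative_type_l2:
  assumes G: "\<And>a. G a \<in> dual_carrier l2_ball"
  shows "negative_type (\<lambda>a b. (dual_norm l2_ball (G a - G b))\<^sup>2)"
  unfolding negative_type_def
proof (intro allI impI)
  fix A B :: "'a list" assume ne: "A \<noteq> []" "B \<noteq> []"
  let ?D = "\<lambda>N a b. \<Sum>n<N. (G a n - G b n)\<^sup>2"
  let ?E = "\<lambda>N A B. avg (\<lambda>a. avg (?D N a) B) A"
  have lim: "(\<lambda>N. ?E N A B) \<longlonglongrightarrow> avg (\<lambda>a. avg (\<lambda>b. (dual_norm l2_ball (G a - G b))\<^sup>2) B) A" for A B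
    using l2_norm_sums[OF l2.dual_carrier_diff[OF G G]] by (intro tendsto_avg) simp
  have "?E N A A + ?E N B B \<le> 2 * ?E N A B" for N
    unfolding avg_sum sum.distrib[symmetric] sum_distrib_left
    by (intro sum_mono square_energy ne)
  then have le: "\<exists>M. \<forall>N\<ge>M. ?E N A A + ?E N B B \<le> 2 * ?E N A B" by blast
  show "avg (\<lambda>a. avg (\<lambda>b. (dual_norm l2_ball (G a - G b))\<^sup>2) A) A +
      avg (\<lambda>a. avg (\<lambda>b. (dual_norm l2_ball (G a - G b))\<^sup>2) B) B
      \<le> 2 * avg (\<lambda>a. avg (\<lambda>b. (dual_norm l2_ball (G a - G b))\<^sup>2) B) A"
    by (rule LIMSEQ_le[OF tendsto_add[OF lim[of A A] lim[of B B]] tendsto_mult_left[OF lim[of B A]] le])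
qed

section \<open>Coarse embeddings by inequalities between reals\<close>

lemma
  assumes "coarse_embedding m1 m2 f"
  shows coarse_embedding_expansion:
      "\<exists>W. \<forall>x\<in>mspace m1. \<forall>y\<in>mspace m1. mdist m1 x y \<le> t \<longrightarrow> mdist m2 (f x) (f y) \<le> W"
    and coarse_embedding_compression:
      "\<exists>t. \<forall>x\<in>mspace m1. \<forall>y\<in>mspace m1. mdist m2 (f x) (f y) \<le> R \<longrightarrow> mdist m1 x y \<le> t"
proof -
  let ?S = "{ennreal (mdist m2 (f x) (f y)) |x y. x \<in> mspace m1 \<and> y \<in> mspace m1 \<and> mdist m1 x y \<le> max t 1}"
  have fin: "Sup ?S < \<infinity>"
  proof -
    have "expansion_modulus m1 m2 f (max t 1) < \<infinity>"
      using assms unfolding coarse_embedding_def by auto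
    then show ?thesis unfolding expansion_modulus_def .
  qed
  have "mdist m2 (f x) (f y) \<le> enn2real (Sup ?S)"
    if "x \<in> mspace m1" "y \<in> mspace m1" "mdist m1 x y \<le> t" for x y
  proof -
    have "ennreal (mdist m2 (f x) (f y)) \<le> Sup ?S" using that by (intro Sup_upper) force
    then have "enn2real (ennreal (mdist m2 (f x) (f y))) \<le> enn2real (Sup ?S)"
      using fin by (intro enn2real_mono) (auto simp: top.not_eq_extremum)
    then show ?thesis by simp
  qed
  then show "\<exists>W. \<forall>x\<in>mspace m1. \<forall>y\<in>mspace m1. mdist m1 x y \<le> t \<longrightarrow> mdist m2 (f x) (f y) \<le> W"
    by blast
next
  have "(compression_modulus m1 m2 f \<longlongrightarrow> \<infinity>) at_top"
    using assms by (simp add: coarse_embedding_def)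
  then have "eventually (\<lambda>t. ennreal R < compression_modulus m1 m2 f t) at_top"
    by (rule order_tendstoD) simp
  then obtain t where t: "ennreal R < compression_modulus m1 m2 f t"
    by (auto simp: eventually_at_top_linorder)
  have "mdist m1 x y \<le> t" if "x \<in> mspace m1" "y \<in> mspace m1" "mdist m2 (f x) (f y) \<le> R" for x y
  proof (rule ccontr)
    assume "\<not> mdist m1 x y \<le> t"
    then have "compression_modulus m1 m2 f t \<le> ennreal (mdist m2 (f x) (f y))"
      unfolding compression_modulus_def using that by (intro Inf_lower) force
    also have "\<dots> \<le> ennreal R" using that(3) by (rule ennreal_leI)
    finally show False using t by simp
  qed
  then show "\<exists>t. \<forall>x\<in>mspace m1. \<forall>y\<in>mspace m1. mdist m2 (f x) (f y) \<le> R \<longrightarrow> mdist m1 x y \<le> t"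
    by blast
qed

section \<open>Flat cubes in seminormed spaces\<close>

text \<open>Seminorms rather than norms: a normed space given on a carrier is later presented as a quotient of
a free vector space.\<close>

locale seminormed_space = vector_space scale
  for scale :: "real \<Rightarrow> 'v::ab_group_add \<Rightarrow> 'v" (infixr "\<cdot>" 75) +
  fixes p :: "'v \<Rightarrow> real"
  assumes triangle: "p (u + v) \<le> p u + p v"
    and homogeneous: "p (c \<cdot> u) = \<bar>c\<bar> * p u"
begin

lemma p_minus: "p (- u) = p u"
  using homogeneous[of "-1" u] by simp

lemma p_diff_commute: "p (u - v) = p (v - u)"
  using p_minus[of "u - v"] by simp

lemma p_diff: "p (u - v) \<le> p u + p v"
  using triangle[of u "- v"] by (simp add: p_minus)

lemma p_diff_triangle: "p (u - w) \<le> p (u - v) + p (v - w)"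
  using triangle[of "u - v" "v - w"] by simp

lemma p_zero: "p 0 = 0"
  using homogeneous[of 0 0] by simp

lemma p_nonneg: "p u \<ge> 0"
  using triangle[of u "- u"] by (simp add: p_minus p_zero)

text \<open>Approximate elements of the span up to null vectors. In the step that adds a vector \<open>b\<close> at distance
\<open>d > 0\<close> from the span, the coefficients of \<open>b\<close> in the approximants form a Cauchy sequence, as a
coefficient \<open>k\<close> contributes at least \<open>\<bar>k\<bar> d\<close> to the norm.\<close>

lemma closed_span:
  assumes "finite B" "\<And>e. e > 0 \<Longrightarrow> \<exists>s\<in>span B. p (v - s) < e"
  shows "\<exists>s\<in>span B. p (v - s) = 0"
  using assms
proof (induction B arbitrary: v rule: finite_induct)
  case empty
  have "p v < e" if "e > 0" for e using empty[OF that] by simp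
  then have "\<not> p v > 0" by blast
  then show ?case using p_nonneg[of v] by simp
next
  case (insert b B)
  have span_mem: "s + k \<cdot> b \<in> span (insert b B)" if "s \<in> span B" for s k
  proof -
    have "s \<in> span (insert b B)" using that span_mono[of B "insert b B"] by blast
    moreover have "k \<cdot> b \<in> span (insert b B)" by (intro span_scale span_base) simp
    ultimately show ?thesis by (rule span_add)
  qed
  have split: "\<exists>s\<in>span B. \<exists>k. p (v - (s + k \<cdot> b)) < e" if e: "e > 0" for e
  proof -
    obtain w where "w \<in> span (insert b B)" "p (v - w) < e" using insert.prems[OF e] by blast
    then obtain k where "w - k \<cdot> b \<in> span B" by (auto simp: span_insert)
    with \<open>p (v - w) < e\<close> show ?thesis by (intro bexI[of _ "w - k \<cdot> b"] exI[of _ k]) auto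
  qed
  show ?case
  proof (cases "\<exists>s\<in>span B. p (b - s) = 0")
    case True
    then obtain s0 where s0: "s0 \<in> span B" "p (b - s0) = 0" by blast
    have "\<exists>s\<in>span B. p (v - s) < e" if e: "e > 0" for e
    proof -
      obtain s k where s: "s \<in> span B" "p (v - (s + k \<cdot> b)) < e" using split[OF e] by blast
      have "p (v - (s + k \<cdot> s0)) \<le> p (v - (s + k \<cdot> b)) + p ((s + k \<cdot> b) - (s + k \<cdot> s0))"
        by (rule p_diff_triangle)
      also have "(s + k \<cdot> b) - (s + k \<cdot> s0) = k \<cdot> (b - s0)" by (simp add: scale_right_diff_distrib)
      also have "p \<dots> = 0" by (simp add: homogeneous s0)
      finally show ?thesis using s s0(1) by (intro bexI[of _ "s + k \<cdot> s0"] span_add span_scale) auto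
    qed
    from insert.IH[OF this] show ?thesis using span_mono[of B "insert b B"] by blast
  next
    case False
    then obtain d where d: "d > 0" "\<And>s. s \<in> span B \<Longrightarrow> d \<le> p (b - s)"
      using insert.IH[of b] by (meson not_le)
    have coeff: "\<bar>k\<bar> * d \<le> p (s + k \<cdot> b)" if s: "s \<in> span B" for s k
    proof (cases "k = 0")
      case True
      then show ?thesis using p_nonneg by simp
    next
      case False
      have "s + k \<cdot> b = k \<cdot> (b - (- (1 / k)) \<cdot> s)"
        using False by (simp add: scale_right_diff_distrib scale_right_distrib algebra_simps)
      then have "p (s + k \<cdot> b) = \<bar>k\<bar> * p (b - (- (1 / k)) \<cdot> s)" by (simp only: homogeneous)
      moreover have "d \<le> p (b - (- (1 / k)) \<cdot> s)" using s by (intro d span_scale)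
      ultimately show ?thesis by (simp add: mult_left_mono)
    qed
    have "\<forall>n::nat. \<exists>s k. s \<in> span B \<and> p (v - (s + k \<cdot> b)) < inverse (Suc n)"
      using split by (meson inverse_positive_iff_positive of_nat_0_less_iff zero_less_Suc)
    then obtain s k where s: "\<And>n. s n \<in> span B" and sk: "\<And>n. p (v - (s n + k n \<cdot> b)) < inverse (Suc n)"
      by metis
    have k_diff: "\<bar>k n - k m\<bar> * d \<le> inverse (Suc n) + inverse (Suc m)" for n m
    proof -
      have "\<bar>k n - k m\<bar> * d \<le> p ((s n - s m) + (k n - k m) \<cdot> b)"
        using s by (intro coeff span_diff)
      also have "(s n - s m) + (k n - k m) \<cdot> b = (s n + k n \<cdot> b) - (s m + k m \<cdot> b)"
        by (simp add: scale_left_diff_distrib algebra_simps)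
      also have "p \<dots> \<le> p ((s n + k n \<cdot> b) - v) + p (v - (s m + k m \<cdot> b))" by (rule p_diff_triangle)
      also have "\<dots> \<le> inverse (Suc n) + inverse (Suc m)"
        using sk[of n] sk[of m] p_diff_commute[of v] by (simp add: add_mono less_imp_le)
      finally show ?thesis .
    qed
    have "Cauchy k"
    proof (rule CauchyI')
      fix e :: real assume "e > 0"
      then obtain M where M: "inverse (Suc M) < e * d / 2"
        using d(1) reals_Archimedean[of "e * d / 2"] by auto
      have "dist (k m) (k n) < e" if "m \<ge> M" "n > m" for m n
      proof -
        have "inverse (real (Suc m)) \<le> inverse (Suc M)" "inverse (real (Suc n)) \<le> inverse (Suc M)"
          using that by (auto simp: le_imp_inverse_le)
        then have "\<bar>k m - k n\<bar> * d < e * d" using k_diff[of m n] M by linarith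
        then show ?thesis using d(1) by (simp add: dist_real_def)
      qed
      then show "\<exists>M. \<forall>m\<ge>M. \<forall>n>m. dist (k m) (k n) < e" by blast
    qed
    then obtain l where l: "k \<longlonglongrightarrow> l" using Cauchy_convergent convergent_def by blast
    have "\<exists>s\<in>span B. p ((v - l \<cdot> b) - s) < e" if "e > 0" for e
    proof -
      have "(\<lambda>n. inverse (real (Suc n)) + \<bar>k n - l\<bar> * p b) \<longlonglongrightarrow> 0 + \<bar>l - l\<bar> * p b"
        by (intro tendsto_intros LIMSEQ_inverse_real_of_nat l)
      then have "eventually (\<lambda>n. inverse (real (Suc n)) + \<bar>k n - l\<bar> * p b < e) sequentially"
        using that by (intro order_tendstoD) auto
      then obtain n where n: "inverse (real (Suc n)) + \<bar>k n - l\<bar> * p b < e"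
        by (auto simp: eventually_sequentially)
      have "(v - l \<cdot> b) - s n = (v - (s n + k n \<cdot> b)) + (k n - l) \<cdot> b"
        by (simp add: scale_left_diff_distrib algebra_simps)
      also have "p \<dots> \<le> p (v - (s n + k n \<cdot> b)) + p ((k n - l) \<cdot> b)" by (rule triangle)
      also have "\<dots> \<le> inverse (real (Suc n)) + \<bar>k n - l\<bar> * p b"
        using sk[of n] by (simp add: homogeneous)
      also have "\<dots> < e" by (rule n)
      finally show ?thesis using s by blast
    qed
    from insert.IH[OF this] obtain t where "t \<in> span B" "p ((v - l \<cdot> b) - t) = 0" by blast
    then show ?thesis using span_mem[of t l] by (auto simp: algebra_simps intro!: bexI[of _ "t + l \<cdot> b"])
  qed
qed

text \<open>If a finite set \<open>B\<close> met every ball of radius \<open>1/2\<close> centred in the unit ball, then each vector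
could be approximated from the span of \<open>B\<close> with relative error \<open>1/2\<close>, and by repetition with
arbitrarily small error, so by \<open>closed_span\<close> the span of \<open>B\<close> would be the whole space up to null
vectors.\<close>

lemma separated_sequence:
  assumes inf: "\<And>B. finite B \<Longrightarrow> \<exists>v. \<forall>s\<in>span B. p (v - s) \<noteq> 0"
  shows "\<exists>x. \<forall>n::nat. p (x n) \<le> 1 \<and> (\<forall>i<n. 1 / 2 \<le> p (x n - x i))"
proof -
  have ex: "\<exists>x. p x \<le> 1 \<and> (\<forall>b\<in>B. 1 / 2 \<le> p (x - b))" if "finite B" for B
  proof (rule ccontr)
    assume none: "\<nexists>x. p x \<le> 1 \<and> (\<forall>b\<in>B. 1 / 2 \<le> p (x - b))"
    have "\<exists>s\<in>span B. p (v - s) \<le> p v / 2 ^ n" for v n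
    proof (induction n)
      case 0
      then show ?case by (intro bexI[of _ 0]) (auto simp: span_zero)
    next
      case (Suc n)
      then obtain s where s: "s \<in> span B" "p (v - s) \<le> p v / 2 ^ n" by blast
      define c where "c = p (v - s)"
      show ?case
      proof (cases "c = 0")
        case True
        then show ?thesis using s p_nonneg[of v] by (intro bexI[of _ s]) (auto simp: c_def)
      next
        case False
        then have c: "c > 0" using p_nonneg[of "v - s"] by (simp add: c_def)
        then have "p ((1 / c) \<cdot> (v - s)) \<le> 1" by (simp add: homogeneous flip: c_def)
        then obtain b where b: "b \<in> B" "p ((1 / c) \<cdot> (v - s) - b) < 1 / 2"
          using none not_le by blast
        have "v - (s + c \<cdot> b) = c \<cdot> ((1 / c) \<cdot> (v - s) - b)"
          using c by (simp add: scale_right_diff_distrib algebra_simps)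
        then have "p (v - (s + c \<cdot> b)) = c * p ((1 / c) \<cdot> (v - s) - b)"
          using c by (simp only: homogeneous)
        also have "\<dots> \<le> c * (1 / 2)" using b c by (intro mult_left_mono) auto
        also have "\<dots> \<le> p v / 2 ^ Suc n" using s(2) by (simp add: c_def)
        finally have "p (v - (s + c \<cdot> b)) \<le> p v / 2 ^ Suc n" .
        moreover have "s + c \<cdot> b \<in> span B" by (rule span_add[OF s(1) span_scale[OF span_base[OF b(1)]]])
        ultimately show ?thesis by blast
      qed
    qed
    note approx = this
    have "\<exists>s\<in>span B. p (v - s) < e" if "e > 0" for v e
    proof -
      have "(\<lambda>n. p v * (1 / 2) ^ n) \<longlonglongrightarrow> p v * 0"
        by (intro tendsto_intros LIMSEQ_realpow_zero) auto
      then have "eventually (\<lambda>n. p v * (1 / 2) ^ n < e) sequentially"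
        using that by (intro order_tendstoD) auto
      then obtain n where "p v * (1 / 2) ^ n < e" by (auto simp: eventually_sequentially)
      then show ?thesis using approx[of v n] by (force simp: power_divide)
    qed
    then show False using closed_span[OF that] inf[OF that] by blast
  qed
  show ?thesis
  proof (rule dependent_wellorder_choice[where P = "\<lambda>x n r. p r \<le> 1 \<and> (\<forall>i<n. 1 / 2 \<le> p (r - x i))"])
    show "\<exists>r. p r \<le> 1 \<and> (\<forall>i<n. 1 / 2 \<le> p (r - x i))" for n and x :: "nat \<Rightarrow> 'v"
      using ex[of "x ` {..<n}"] by auto
  qed simp
qed

end

text \<open>Of period \<open>4 T\<close> and with slopes \<open>1\<close> and \<open>-1\<close>: a unit step always moves the value by exactly one, so
that stepping in all coordinates produces a signed sum of the \<open>y\<^sub>j\<close>.\<close>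

definition triangle_wave :: "int \<Rightarrow> int \<Rightarrow> int" where
  "triangle_wave T r = \<bar>r mod (4 * T) - 2 * T\<bar>"

lemma triangle_wave_mod: "triangle_wave T (r mod (4 * T)) = triangle_wave T r"
  by (simp add: triangle_wave_def)

lemma triangle_wave_Suc:
  assumes "T > 0"
  shows "\<bar>triangle_wave T (r + 1) - triangle_wave T r\<bar> = 1"
proof -
  define s where "s = r mod (4 * T)"
  have s: "0 \<le> s" "s < 4 * T" using assms by (auto simp: s_def)
  have "(r + 1) mod (4 * T) = (s + 1) mod (4 * T)" by (simp add: s_def mod_add_left_eq)
  also have "\<dots> = (if s + 1 = 4 * T then 0 else s + 1)" using s by auto
  finally have "(r + 1) mod (4 * T) = (if s + 1 = 4 * T then 0 else s + 1)" .
  then show ?thesis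
    unfolding triangle_wave_def s_def[symmetric] using s assms by (auto simp: abs_if)
qed

lemma triangle_wave_step:
  assumes "T > 0" "\<bar>v\<bar> = 1"
  shows "\<bar>triangle_wave T (r + v) - triangle_wave T r\<bar> = 1"
proof (cases "v = 1")
  case False
  then have "v = -1" using assms(2) by auto
  then show ?thesis using triangle_wave_Suc[OF assms(1), of "r - 1"] by (simp add: abs_minus_commute)
qed (use triangle_wave_Suc[OF assms(1)] in simp)

lemma triangle_wave_descent:
  assumes "T > 0" "\<bar>w\<bar> \<le> T"
    and "if 0 \<le> w then r mod (4 * T) < T else T \<le> r mod (4 * T) \<and> r mod (4 * T) < 2 * T"
  shows "\<bar>triangle_wave T (r + w) - triangle_wave T r\<bar> = \<bar>w\<bar>"
proof -
  define s where "s = r mod (4 * T)"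
  have s: "0 \<le> s" "s < 4 * T" using assms by (auto simp: s_def)
  have "(r + w) mod (4 * T) = (s + w) mod (4 * T)" by (simp add: s_def mod_add_left_eq)
  also have "\<dots> = s + w" using s assms(2,3) by (auto simp flip: s_def split: if_splits)
  finally show ?thesis using s assms by (auto simp: triangle_wave_def simp flip: s_def split: if_splits)
qed

context seminormed_space
begin

text \<open>The map \<open>m \<mapsto> g (x(m\<^sub>1) + \<dots> + x(m\<^sub>k))\<close> concentrates on a cube of tuples. Opposite vertices of that
cube differ by a signed sum of the vectors \<open>x a - x b\<close>, for \<open>(a, b)\<close> in the list of pairs, so all
choices of signs come from one application of \<open>concentration\<close>.\<close>

lemma flat_vectors:
  fixes x :: "nat \<Rightarrow> 'v" and g :: "'v \<Rightarrow> nat \<Rightarrow> real"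
  assumes x: "\<And>n. p (x n) \<le> 1" "\<And>n i. i < n \<Longrightarrow> 1 / 2 \<le> p (x n - x i)"
    and mem: "\<And>u. g u \<in> dual_carrier tsirelson_ball"
    and expansion: "\<And>t. \<exists>W. \<forall>u v. p (u - v) \<le> t \<longrightarrow> dual_norm tsirelson_ball (g u - g v) \<le> W"
    and compression: "\<And>R. \<exists>t. \<forall>u v. dual_norm tsirelson_ball (g u - g v) \<le> R \<longrightarrow> p (u - v) \<le> t"
  shows "\<exists>C. \<forall>k::nat. \<exists>y. (\<forall>i<k. 1 / 2 \<le> p (y i)) \<and>
    (\<forall>\<epsilon>. (\<forall>i<k. \<bar>\<epsilon> i\<bar> = 1) \<longrightarrow> p (\<Sum>i<k. \<epsilon> i \<cdot> y i) \<le> C)"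
proof -
  obtain W where W: "\<And>u v. p (u - v) \<le> 2 \<Longrightarrow> dual_norm tsirelson_ball (g u - g v) \<le> W"
    using expansion by blast
  define L where "L = max W 1"
  obtain C where C: "\<And>u v. dual_norm tsirelson_ball (g u - g v) \<le> 8 * L \<Longrightarrow> p (u - v) \<le> C"
    using compression by blast
  have norm_le: "tsirelson_le (g u - g v) c \<longleftrightarrow> dual_norm tsirelson_ball (g u - g v) \<le> c" for u v c
    using tsirelson.dual_norm_le_iff[OF tsirelson.dual_carrier_diff[OF mem mem]] by blast
  define S where "S m = (\<Sum>n\<leftarrow>m. x n)" for m
  have "\<exists>y. (\<forall>i<k. 1 / 2 \<le> p (y i)) \<and>
    (\<forall>\<epsilon>. (\<forall>i<k. \<bar>\<epsilon> i\<bar> = 1) \<longrightarrow> p (\<Sum>i<k. \<epsilon> i \<cdot> y i) \<le> C)" for k :: nat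
  proof -
    have lip: "tsirelson_le (g (S (m @ a # m')) - g (S (m @ b # m'))) L" for m a b m'
    proof -
      have "S (m @ a # m') - S (m @ b # m') = x a - x b" by (simp add: S_def)
      then have "p (S (m @ a # m') - S (m @ b # m')) \<le> 2"
        using p_diff[of "x a" "x b"] x(1)[of a] x(1)[of b] by simp
      then show ?thesis using W unfolding norm_le L_def by fastforce
    qed
    have "L > 0" by (simp add: L_def)
    obtain ps where ps: "length ps = k" "\<forall>q\<in>set ps. fst q \<noteq> snd q"
      and conc: "\<And>m m'. selects m ps \<Longrightarrow> selects m' ps \<Longrightarrow> tsirelson_le (g (S m) - g (S m')) (8 * L)"
      using concentration[of "\<lambda>m. g (S m)" L k, OF mem lip \<open>L > 0\<close>] by blast
    define y where "y i = x (fst (ps ! i)) - x (snd (ps ! i))" for i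
    have "1 / 2 \<le> p (y i)" if "i < k" for i
    proof -
      have "fst (ps ! i) \<noteq> snd (ps ! i)" using ps that by auto
      then show ?thesis
        using x(2) p_diff_commute unfolding y_def by (metis linorder_neqE_nat)
    qed
    moreover have "p (\<Sum>i<k. \<epsilon> i \<cdot> y i) \<le> C" if \<epsilon>: "\<forall>i<k. \<bar>\<epsilon> i\<bar> = 1" for \<epsilon>
    proof -
      define h where "h i = (if \<epsilon> i = 1 then fst (ps ! i) else snd (ps ! i))" for i
      define h' where "h' i = (if \<epsilon> i = 1 then snd (ps ! i) else fst (ps ! i))" for i
      have S: "S (map f [0..<k]) = (\<Sum>i<k. x (f i))" for f
        by (simp add: S_def comp_def interv_sum_list_conv_sum_set_nat atLeast0LessThan)
      have "selects (map h [0..<k]) ps" "selects (map h' [0..<k]) ps"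
        using ps(1) by (auto simp: list_all2_conv_all_nth h_def h'_def)
      then have "p (S (map h [0..<k]) - S (map h' [0..<k])) \<le> C"
        using conc C norm_le by blast
      moreover have "S (map h [0..<k]) - S (map h' [0..<k]) = (\<Sum>i<k. \<epsilon> i \<cdot> y i)"
        unfolding S sum_subtractf[symmetric]
      proof (rule sum.cong[OF refl])
        fix i assume "i \<in> {..<k}"
        then have "\<epsilon> i = 1 \<or> \<epsilon> i = - 1" using \<epsilon> by (auto simp: abs_if split: if_splits)
        then show "x (h i) - x (h' i) = \<epsilon> i \<cdot> y i"
          by (auto simp: h_def h'_def y_def)
      qed
      ultimately show ?thesis by simp
    qed
    ultimately show ?thesis by blast
  qed
  then show ?thesis by blast
qed

text \<open>The torus is mapped by \<open>F z = \<Sum>\<^sub>j triangle_wave (z\<^sub>j) y\<^sub>j\<close>. One step in all coordinates moves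
\<open>F\<close> by at most \<open>C\<close>, and \<open>w\<close> steps down one slope move it by at least \<open>\<bar>w\<bar>/2\<close>. The constants \<open>R\<close> and
\<open>n\<close> are chosen so that \<open>R\<^sup>2 > 48 W\<^sup>2\<close> and that \<open>2 w\<^sup>2 \<ge> 2\<^sup>n\<close> implies \<open>\<bar>w\<bar>/2 > t\<close>.\<close>

lemma flat_vectors_not_hilbertian:
  fixes g :: "'v \<Rightarrow> nat \<Rightarrow> real"
  assumes flat: "\<And>k::nat. \<exists>y. (\<forall>i<k. 1 / 2 \<le> p (y i)) \<and>
      (\<forall>\<epsilon>. (\<forall>i<k. \<bar>\<epsilon> i\<bar> = 1) \<longrightarrow> p (\<Sum>i<k. \<epsilon> i \<cdot> y i) \<le> C)"
    and mem: "\<And>u. g u \<in> dual_carrier l2_ball"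
    and expansion: "\<And>t. \<exists>W. \<forall>u v. p (u - v) \<le> t \<longrightarrow> dual_norm l2_ball (g u - g v) \<le> W"
    and compression: "\<And>R. \<exists>t. \<forall>u v. dual_norm l2_ball (g u - g v) \<le> R \<longrightarrow> p (u - v) \<le> t"
  shows False
proof -
  obtain W where W: "\<And>u v. p (u - v) \<le> C \<Longrightarrow> dual_norm l2_ball (g u - g v) \<le> W"
    using expansion by blast
  have norm_nonneg: "dual_norm l2_ball (g u - g v) \<ge> 0" for u v
    by (rule l2.dual_norm_nonneg[OF l2.dual_carrier_diff[OF mem mem]])
  have "p 0 \<le> C" using flat[of 0] by simp
  then have "W \<ge> 0" using W[of 0 0] norm_nonneg[of 0 0] by simp
  define R where "R = 7 * W + 1"
  obtain t where t: "\<And>u v. dual_norm l2_ball (g u - g v) \<le> R \<Longrightarrow> p (u - v) \<le> t"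
    using compression by blast
  obtain n :: nat where n: "8 * t\<^sup>2 < 2 ^ n" using real_arch_pow[of 2 "8 * t\<^sup>2"] by auto
  define T :: int where "T = 2 ^ n"
  have T: "T > 0" by (simp add: T_def)
  obtain y :: "nat \<Rightarrow> 'v" where y: "\<And>i. i < 2 ^ n \<Longrightarrow> 1 / 2 \<le> p (y i)"
    and signs: "\<And>\<epsilon>. (\<And>i. i < 2 ^ n \<Longrightarrow> \<bar>\<epsilon> i\<bar> = 1) \<Longrightarrow> p (\<Sum>i<2 ^ n. \<epsilon> i \<cdot> y i) \<le> C"
    using flat[of "2 ^ n"] by blast
  define F where "F z = (\<Sum>j<2 ^ n. real_of_int (triangle_wave T (z j)) \<cdot> y j)" for z :: "nat \<Rightarrow> int"
  have F_diff: "F z' - F z = (\<Sum>j<2 ^ n. real_of_int (triangle_wave T (z' j) - triangle_wave T (z j)) \<cdot> y j)" for z z'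
    by (simp add: F_def scale_left_diff_distrib sum_subtractf)
  have "R\<^sup>2 \<le> 48 * W\<^sup>2"
  proof (rule cube_obstruction[where p = F and n = n and D = "\<lambda>u v. (dual_norm l2_ball (g u - g v))\<^sup>2"])
    show "negative_type (\<lambda>u v. (dual_norm l2_ball (g u - g v))\<^sup>2)"
      by (rule negative_type_l2[OF mem])
    show "F (reduce (2 ^ n) (4 * 2 ^ n) z) = F z" for z
      unfolding F_def using triangle_wave_mod[of T]
      by (intro sum.cong) (auto simp: reduce_def T_def)
    show "(dual_norm l2_ball (g (F z) - g (F (z + v))))\<^sup>2 \<le> W\<^sup>2"
      if v: "\<And>j. j < 2 ^ n \<Longrightarrow> \<bar>v j\<bar> = 1" for z v
    proof -
      have "\<bar>real_of_int (triangle_wave T ((z + v) j) - triangle_wave T (z j))\<bar> = 1" if "j < 2 ^ n" for j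
        using triangle_wave_step[OF T v[OF that], of "z j"] by (simp flip: of_int_abs of_int_diff)
      then have "p (F (z + v) - F z) \<le> C" unfolding F_diff by (intro signs)
      then have "dual_norm l2_ball (g (F z) - g (F (z + v))) \<le> W"
        by (intro W) (simp add: p_diff_commute)
      then show ?thesis using norm_nonneg by (intro power_mono)
    qed
    show "R\<^sup>2 \<le> (dual_norm l2_ball (g (F z) - g (F (z + axis_point i w))))\<^sup>2"
      if i: "i < 2 ^ n" and w: "2 ^ n \<le> 2 * w\<^sup>2" "\<bar>w\<bar> \<le> 2 ^ n"
        and r: "if 0 \<le> w then z i mod (4 * 2 ^ n) < 2 ^ n
          else 2 ^ n \<le> z i mod (4 * 2 ^ n) \<and> z i mod (4 * 2 ^ n) < 2 * 2 ^ n"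
      for i z w
    proof -
      have "F (z + axis_point i w) - F z =
          (\<Sum>j<2 ^ n. if j = i then real_of_int (triangle_wave T (z i + w) - triangle_wave T (z i)) \<cdot> y i else 0)"
        unfolding F_diff by (intro sum.cong) (auto simp: axis_point_def)
      also have "\<dots> = real_of_int (triangle_wave T (z i + w) - triangle_wave T (z i)) \<cdot> y i"
        using i by simp
      finally have "p (F (z + axis_point i w) - F z) = \<bar>real_of_int (triangle_wave T (z i + w) - triangle_wave T (z i))\<bar> * p (y i)"
        by (simp only: homogeneous)
      also have "\<bar>real_of_int (triangle_wave T (z i + w) - triangle_wave T (z i))\<bar> = \<bar>real_of_int w\<bar>"
        using triangle_wave_descent[OF T, of w "z i"] w r unfolding T_def[symmetric] by (metis of_int_abs)
      finally have "p (F (z + axis_point i w) - F z) = \<bar>real_of_int w\<bar> * p (y i)" .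
      then have far: "\<bar>real_of_int w\<bar> / 2 \<le> p (F z - F (z + axis_point i w))"
        unfolding p_diff_commute[of "F z"]
        using mult_left_mono[OF y[OF i], of "\<bar>real_of_int w\<bar>"] by (simp del: plus_fun_apply)
      have "t < \<bar>real_of_int w\<bar> / 2"
      proof (rule ccontr)
        assume "\<not> t < \<bar>real_of_int w\<bar> / 2"
        then have "(\<bar>real_of_int w\<bar> / 2)\<^sup>2 \<le> t\<^sup>2" by (intro power_mono) auto
        moreover have "2 ^ n \<le> 2 * (real_of_int w)\<^sup>2"
          using of_int_le_iff[of "2 ^ n" "2 * w\<^sup>2", where ?'a = real] w(1) by simp
        ultimately show False using n by (simp add: power_divide)
      qed
      then have "\<not> dual_norm l2_ball (g (F z) - g (F (z + axis_point i w))) \<le> R" using t far by fastforce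
      then show ?thesis using \<open>W \<ge> 0\<close> by (intro power_mono) (auto simp: R_def)
    qed
  qed auto
  moreover have "48 * W\<^sup>2 < R\<^sup>2"
    using \<open>W \<ge> 0\<close> by (simp add: R_def power2_eq_square algebra_simps add_pos_nonneg add_strict_increasing)
  ultimately show False by simp
qed

end

section \<open>Normed spaces on carriers\<close>

definition pm_scale :: "real \<Rightarrow> ('a, real) poly_mapping \<Rightarrow> ('a, real) poly_mapping" where
  "pm_scale r c = Poly_Mapping.map ((*) r) c"

lemma lookup_pm_scale: "Poly_Mapping.lookup (pm_scale r c) a = r * Poly_Mapping.lookup c a"
  by (simp add: pm_scale_def Poly_Mapping.map.rep_eq when_def)

text \<open>Formal linear combinations of elements form a vector space on a type, and \<open>lin X\<close> evaluates them.
Pulling the norm back along \<open>lin X\<close> reduces the study of \<open>X\<close> to a seminorm on that type. Elements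
outside the carrier are ignored, so that evaluation is total and linear.\<close>

definition lin :: "'a normed_space \<Rightarrow> ('a, real) poly_mapping \<Rightarrow> 'a" where
  "lin X c = (\<Oplus>\<^bsub>X\<^esub>a\<in>Poly_Mapping.keys c \<inter> carrier X. Poly_Mapping.lookup c a \<odot>\<^bsub>X\<^esub> a)"

locale carrier_space =
  fixes X :: "'a normed_space"
  assumes normed: "real_normed_space X"
begin

sublocale Mod: Module.module real_ring X
  using normed by (simp add: real_normed_space_def)

lemma real_ring_simps [simp]:
  "r \<in> carrier real_ring" "\<zero>\<^bsub>real_ring\<^esub> = 0" "\<one>\<^bsub>real_ring\<^esub> = 1"
  "r \<oplus>\<^bsub>real_ring\<^esub> s = r + s" "r \<otimes>\<^bsub>real_ring\<^esub> s = r * s"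
  by (simp_all add: real_ring_def)

lemma zero_smult: "a \<in> carrier X \<Longrightarrow> 0 \<odot>\<^bsub>X\<^esub> a = \<zero>\<^bsub>X\<^esub>"
  using Mod.smult_l_null[of a] by simp

lemma smult_add: "a \<in> carrier X \<Longrightarrow> (r + s) \<odot>\<^bsub>X\<^esub> a = r \<odot>\<^bsub>X\<^esub> a \<oplus>\<^bsub>X\<^esub> s \<odot>\<^bsub>X\<^esub> a"
  using Mod.smult_l_distr[of r s a] by simp

lemma one_smult: "a \<in> carrier X \<Longrightarrow> 1 \<odot>\<^bsub>X\<^esub> a = a"
  using Mod.smult_one[of a] unfolding real_ring_simps .

lemma smult_smult: "a \<in> carrier X \<Longrightarrow> r \<odot>\<^bsub>X\<^esub> (s \<odot>\<^bsub>X\<^esub> a) = (r * s) \<odot>\<^bsub>X\<^esub> a"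
  using Mod.smult_assoc1[of r s a] by simp

lemma eq_if_diff_zero:
  assumes "x \<in> carrier X" "y \<in> carrier X" "x \<ominus>\<^bsub>X\<^esub> y = \<zero>\<^bsub>X\<^esub>"
  shows "x = y"
proof -
  have "(x \<ominus>\<^bsub>X\<^esub> y) \<oplus>\<^bsub>X\<^esub> y = x"
    using assms(1,2) by (simp add: a_minus_def Mod.M.a_assoc Mod.M.l_neg)
  then show ?thesis using assms by simp
qed

lemma lin_eq:
  assumes "finite S" "S \<subseteq> carrier X" "Poly_Mapping.keys c \<inter> carrier X \<subseteq> S"
  shows "lin X c = (\<Oplus>\<^bsub>X\<^esub>a\<in>S. Poly_Mapping.lookup c a \<odot>\<^bsub>X\<^esub> a)"
  unfolding lin_def
proof (rule Mod.M.add.finprod_mono_neutral_cong_left)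
  fix a assume "a \<in> S - Poly_Mapping.keys c \<inter> carrier X"
  then show "Poly_Mapping.lookup c a \<odot>\<^bsub>X\<^esub> a = \<zero>\<^bsub>X\<^esub>"
    using assms(2) by (auto simp: in_keys_iff zero_smult)
qed (use assms in auto)

lemma lin_closed: "lin X c \<in> carrier X"
  unfolding lin_def by (rule Mod.M.finsum_closed) auto

lemma lin_add: "lin X (c + d) = lin X c \<oplus>\<^bsub>X\<^esub> lin X d"
proof -
  let ?S = "(Poly_Mapping.keys c \<union> Poly_Mapping.keys d) \<inter> carrier X"
  have "lin X e = (\<Oplus>\<^bsub>X\<^esub>a\<in>?S. Poly_Mapping.lookup e a \<odot>\<^bsub>X\<^esub> a)"
    if "Poly_Mapping.keys e \<subseteq> Poly_Mapping.keys c \<union> Poly_Mapping.keys d" for e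
    using that by (intro lin_eq) auto
  note eq = this
  have "lin X (c + d) = (\<Oplus>\<^bsub>X\<^esub>a\<in>?S. Poly_Mapping.lookup c a \<odot>\<^bsub>X\<^esub> a \<oplus>\<^bsub>X\<^esub> Poly_Mapping.lookup d a \<odot>\<^bsub>X\<^esub> a)"
    unfolding eq[OF Poly_Mapping.keys_add]
    by (rule Mod.M.finsum_cong) (auto simp: lookup_add smult_add simp_implies_def Pi_def)
  also have "\<dots> = lin X c \<oplus>\<^bsub>X\<^esub> lin X d"
    using Mod.M.finsum_addf[of "\<lambda>a. Poly_Mapping.lookup c a \<odot>\<^bsub>X\<^esub> a" ?S "\<lambda>a. Poly_Mapping.lookup d a \<odot>\<^bsub>X\<^esub> a"]
    by (simp add: eq)
  finally show ?thesis .
qed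

lemma lin_scale: "lin X (pm_scale r c) = r \<odot>\<^bsub>X\<^esub> lin X c"
proof -
  let ?S = "Poly_Mapping.keys c \<inter> carrier X"
  have "lin X (pm_scale r c) = (\<Oplus>\<^bsub>X\<^esub>a\<in>?S. Poly_Mapping.lookup (pm_scale r c) a \<odot>\<^bsub>X\<^esub> a)"
    by (rule lin_eq) (auto simp: in_keys_iff lookup_pm_scale)
  also have "\<dots> = (\<Oplus>\<^bsub>X\<^esub>a\<in>?S. r \<odot>\<^bsub>X\<^esub> (Poly_Mapping.lookup c a \<odot>\<^bsub>X\<^esub> a))"
    by (rule Mod.M.finsum_cong) (auto simp: lookup_pm_scale smult_smult simp_implies_def Pi_def)
  also have "\<dots> = r \<odot>\<^bsub>X\<^esub> lin X c"
    unfolding lin_def by (rule Mod.finsum_smult_ldistr[symmetric]) auto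
  finally show ?thesis .
qed

lemma lin_single: "a \<in> carrier X \<Longrightarrow> lin X (Poly_Mapping.single a 1) = a"
  using lin_eq[of "{a}" "Poly_Mapping.single a 1"] Mod.M.finsum_insert[of "{}" a "\<lambda>a. Poly_Mapping.lookup (Poly_Mapping.single a 1) a \<odot>\<^bsub>X\<^esub> a"]
  by (simp add: one_smult)

lemma lin_diff: "lin X (c - d) = lin X c \<ominus>\<^bsub>X\<^esub> lin X d"
proof -
  have "lin X c = lin X (c - d) \<oplus>\<^bsub>X\<^esub> lin X d" using lin_add[of "c - d" d] by simp
  then show ?thesis
    using lin_closed[of c] lin_closed[of d] lin_closed[of "c - d"]
    by (simp add: a_minus_def Mod.M.a_assoc Mod.M.r_neg)
qed

sublocale seminormed_space pm_scale "\<lambda>c. nrm X (lin X c)"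
proof
  show "nrm X (lin X (c + d)) \<le> nrm X (lin X c) + nrm X (lin X d)" for c d
    using normed lin_closed by (auto simp: lin_add real_normed_space_def)
  show "nrm X (lin X (pm_scale r c)) = \<bar>r\<bar> * nrm X (lin X c)" for r c
    using normed lin_closed by (auto simp: lin_scale real_normed_space_def)
qed (auto intro!: poly_mapping_eqI simp: lookup_pm_scale lookup_add algebra_simps)

lemma mdist_lin: "mdist (norm_metric X) (lin X c) (lin X d) = nrm X (lin X (c - d))"
  using mdist_norm_metric[OF normed lin_closed lin_closed] by (simp add: lin_diff)

lemma not_span_if_infinite_dimensional:
  assumes "infinite_dimensional X" "finite B"
  shows "\<exists>v. \<forall>s\<in>span B. nrm X (lin X (v - s)) \<noteq> 0"
proof (rule ccontr)
  assume none: "\<not> ?thesis"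
  let ?S = "(\<Union>c\<in>B. Poly_Mapping.keys c) \<inter> carrier X"
  have keys: "Poly_Mapping.keys s \<inter> carrier X \<subseteq> ?S" if "s \<in> span B" for s
    using that
  proof (induction rule: span_induct_alt)
    case (step r c s)
    have "Poly_Mapping.keys (pm_scale r c + s) \<subseteq> Poly_Mapping.keys c \<union> Poly_Mapping.keys s"
      by (auto simp: in_keys_iff lookup_add lookup_pm_scale)
    then show ?case using step by blast
  qed auto
  have "\<exists>c::'a \<Rightarrow> real. x = (\<Oplus>\<^bsub>X\<^esub>b\<in>?S. c b \<odot>\<^bsub>X\<^esub> b)" if x: "x \<in> carrier X" for x
  proof -
    obtain s where s: "s \<in> span B" "nrm X (lin X (Poly_Mapping.single x 1 - s)) = 0"
      using none by blast
    then have "x \<ominus>\<^bsub>X\<^esub> lin X s = \<zero>\<^bsub>X\<^esub>"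
      using normed lin_closed[of "Poly_Mapping.single x 1 - s"] x
      unfolding real_normed_space_def by (metis lin_diff lin_single)
    then have "x = lin X s"
      using eq_if_diff_zero[OF x lin_closed] by blast
    also have "\<dots> = (\<Oplus>\<^bsub>X\<^esub>b\<in>?S. Poly_Mapping.lookup s b \<odot>\<^bsub>X\<^esub> b)"
      using \<open>finite B\<close> keys[OF s(1)] by (intro lin_eq) auto
    finally show ?thesis by blast
  qed
  then have "finite_dimensional X"
    unfolding finite_dimensional_def using \<open>finite B\<close> by (intro exI[of _ ?S]) auto
  then show False using assms(1) by simp
qed

lemma sequences_inject:
  assumes "infinite_dimensional X"
  shows "\<exists>j :: (nat \<Rightarrow> real) \<Rightarrow> 'a. inj j"
proof -
  obtain v where v: "v \<in> carrier X" "v \<noteq> \<zero>\<^bsub>X\<^esub>"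
  proof (rule ccontr)
    assume "\<not> thesis"
    then have "\<forall>x\<in>carrier X. x = \<zero>\<^bsub>X\<^esub>" using that by blast
    then have "finite_dimensional X"
      unfolding finite_dimensional_def by (intro exI[of _ "{}"]) auto
    then show False using assms by simp
  qed
  have "inj (\<lambda>r. r \<odot>\<^bsub>X\<^esub> v)"
  proof (rule injI)
    fix r s assume eq: "r \<odot>\<^bsub>X\<^esub> v = s \<odot>\<^bsub>X\<^esub> v"
    have "(r - s) \<odot>\<^bsub>X\<^esub> v \<oplus>\<^bsub>X\<^esub> s \<odot>\<^bsub>X\<^esub> v = s \<odot>\<^bsub>X\<^esub> v"
      using smult_add[OF v(1), of "r - s" s] eq by simp
    then have "(r - s) \<odot>\<^bsub>X\<^esub> v = \<zero>\<^bsub>X\<^esub>"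
      using v(1) Mod.M.add.right_cancel[of "s \<odot>\<^bsub>X\<^esub> v" "(r - s) \<odot>\<^bsub>X\<^esub> v" "\<zero>\<^bsub>X\<^esub>"] by simp
    then have "\<bar>r - s\<bar> * nrm X v = 0"
      using normed v Mod.smult_closed[of "r - s" v] unfolding real_normed_space_def by (metis real_ring_simps(1))
    moreover have "nrm X v \<noteq> 0" using normed v by (auto simp: real_normed_space_def)
    ultimately show "r = s" by simp
  qed
  moreover obtain h :: "(nat \<Rightarrow> real) \<Rightarrow> real" where "inj h"
    using sequences_lepoll_reals unfolding lepoll_def by blast
  ultimately have "inj ((\<lambda>r. r \<odot>\<^bsub>X\<^esub> v) \<circ> h)" by (intro inj_compose)
  then show ?thesis by blast
qed

lemma coarse_map_to_sequences:
  assumes "dual_space B j" and f: "coarse_embedding (norm_metric X) (norm_metric (seq_space j B)) f"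
  defines "g \<equiv> \<lambda>c. decode j (f (lin X c))"
  shows "g c \<in> dual_carrier B"
    and "\<exists>W. \<forall>c d. nrm X (lin X (c - d)) \<le> t \<longrightarrow> dual_norm B (g c - g d) \<le> W"
    and "\<exists>t. \<forall>c d. dual_norm B (g c - g d) \<le> R \<longrightarrow> nrm X (lin X (c - d)) \<le> t"
proof -
  interpret Y: dual_space B j by (rule assms(1))
  have "f ` carrier X \<subseteq> j ` dual_carrier B"
    using f normed Y.normed_seq_space by (simp add: coarse_embedding_def)
  then have fl: "f (lin X c) \<in> j ` dual_carrier B" for c using lin_closed by blast
  show mem: "g c \<in> dual_carrier B" for c using fl[of c] by (auto simp: g_def)
  have jg: "f (lin X c) = j (g c)" for c using fl[of c] by (auto simp: g_def)
  have dist: "mdist (norm_metric Y.Y) (f (lin X c)) (f (lin X d)) = dual_norm B (g c - g d)" for c d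
    unfolding jg by (rule Y.mdist_seq_space[OF mem mem])
  have lin_mem: "lin X c \<in> mspace (norm_metric X)" for c using lin_closed normed by simp
  show "\<exists>W. \<forall>c d. nrm X (lin X (c - d)) \<le> t \<longrightarrow> dual_norm B (g c - g d) \<le> W"
    using coarse_embedding_expansion[OF f, of t] lin_mem unfolding dist[symmetric] mdist_lin[symmetric] by blast
  show "\<exists>t. \<forall>c d. dual_norm B (g c - g d) \<le> R \<longrightarrow> nrm X (lin X (c - d)) \<le> t"
    using coarse_embedding_compression[OF f, of R] lin_mem unfolding dist[symmetric] mdist_lin[symmetric] by blast
qed

theorem no_embedding_into_both:
  assumes inf: "infinite_dimensional X" and j: "inj j"
    and f1: "coarse_embedding (norm_metric X) (norm_metric (seq_space j tsirelson_ball)) f1"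
    and f2: "coarse_embedding (norm_metric X) (norm_metric (seq_space j l2_ball)) f2"
  shows False
proof -
  have D1: "dual_space tsirelson_ball j" and D2: "dual_space l2_ball j"
    by (intro dual_space.intro dual_space_axioms.intro tsirelson.test_set_axioms l2.test_set_axioms j)+
  obtain x where x: "\<And>n::nat. nrm X (lin X (x n)) \<le> 1"
    "\<And>n i. i < n \<Longrightarrow> 1 / 2 \<le> nrm X (lin X (x n - x i))"
    using separated_sequence not_span_if_infinite_dimensional[OF inf] by blast
  obtain C where "\<And>k::nat. \<exists>y. (\<forall>i<k. 1 / 2 \<le> nrm X (lin X (y i))) \<and>
    (\<forall>\<epsilon>. (\<forall>i<k. \<bar>\<epsilon> i\<bar> = 1) \<longrightarrow> nrm X (lin X (\<Sum>i<k. pm_scale (\<epsilon> i) (y i))) \<le> C)"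
    using flat_vectors[OF x coarse_map_to_sequences[OF D1 f1]] by blast
  then show False
    by (rule flat_vectors_not_hilbertian[OF _ coarse_map_to_sequences[OF D2 f2]])
qed

end

theorem corollaryC:
  shows "\<not> (\<exists>X :: 'a normed_space.
    banach_space X \<and> infinite_dimensional X \<and> coarsely_minimal X)"
proof
  assume "\<exists>X :: 'a normed_space. banach_space X \<and> infinite_dimensional X \<and> coarsely_minimal X"
  then obtain X :: "'a normed_space" where X: "real_normed_space X" "infinite_dimensional X" "coarsely_minimal X"
    by (auto simp: banach_space_def)
  interpret carrier_space X by (rule carrier_space.intro) (rule X)
  obtain j :: "(nat \<Rightarrow> real) \<Rightarrow> 'a" where j: "inj j" using sequences_inject[OF X(2)] by blast
  have embeds: "coarsely_embeds (norm_metric X) (norm_metric (seq_space j B))"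
    if "test_set B" "\<And>x n. x \<in> B \<Longrightarrow> \<bar>x n\<bar> \<le> 1" for B
  proof -
    interpret Y: dual_space B j using that(1) j by (intro dual_space.intro dual_space_axioms.intro)
    have "unit_seq n \<in> dual_carrier B" for n
      using that(2)[of _ n] by (intro Y.unit_seq_dual_carrier) fastforce
    then show ?thesis
      using X(3) Y.banach_seq_space Y.infinite_dimensional_seq_space unfolding coarsely_minimal_def by blast
  qed
  have "coarsely_embeds (norm_metric X) (norm_metric (seq_space j l2_ball))"
    by (intro embeds l2.test_set_axioms l2_ball_coord)
  moreover have "coarsely_embeds (norm_metric X) (norm_metric (seq_space j tsirelson_ball))"
    by (intro embeds tsirelson.test_set_axioms tsirelson_ball_coord)
  ultimately show False
    using no_embedding_into_both[OF X(2) j] by (auto simp: coarsely_embeds_def)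
qed

end
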